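(* Let $\Gamma$ be a finite abelian group. The following diagram is well defined and commutes: $$\begin{array}{ccc}\overline{\mathrm{GARI}}(\Gamma)_{\mathrm{as}} & \xrightarrow{\ \mathrm{ganit}_v(\mathrm{pic})\ } & \overline{\mathrm{GARI}}(\Gamma)_{\mathrm{is}}\\ {\scriptstyle\exp_\times}\uparrow & & \uparrow{\scriptstyle\exp_\times}\\ \overline{\mathrm{ARI}}(\Gamma)_{\mathrm{al}} & \xrightarrow{\ \mathrm{ganit}_v(\mathrm{pic})\ } & \overline{\mathrm{ARI}}(\Gamma)_{\mathrm{il}}\end{array}$$ that is, each of the four maps carries its indicated source into its indicated target, and $\mathrm{ganit}_v(\mathrm{pic})(\exp_\times(A))=\exp_\times(\mathrm{ganit}_v(\mathrm{pic})(A))$ for all $A\in\overline{\mathrm{ARI}}(\Gamma)_{\mathrm{al}}$.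
   Context: Moulds. $\Gamma$ is a finite abelian group, written multiplicatively. A mould is a sequence $M=(M(x_1,\dots,x_m))_{m\ge 0}$ with $M(\emptyset)\in\mathbb{Q}$ and, for $m\ge1$, $M(x_1,\dots,x_m)$ a family of rational functions $M_{\sigma_1,\dots,\sigma_m}(x_1,\dots,x_m)\in\mathbb{Q}(x_1,\dots,x_m)$ indexed by $(\sigma_1,\dots,\sigma_m)\in\Gamma^{m}$. $\overline{\mathrm{BIMU}}(\Gamma)$ denotes the set of all moulds, with variables called $v_i$ and components written $M\binom{\sigma_1,\dots,\sigma_m}{v_1,\dots,v_m}$. It is a $\mathbb{Q}$-vector space componentwise and a unital associative algebra with product $(A\times B)_{\sigma_1,\dots,\sigma_m}(x_1,\dots,x_m)=\sum_{i=0}^m A_{\sigma_1,\dots,\sigma_i}(x_1,\dots,x_i)B_{\sigma_{i+1},\dots,\sigma_m}(x_{i+1},\dots,x_m)$ and unit $I=(1,0,0,\dots)$. Put $\overline{\mathrm{ARI}}(\Gamma)=\{M: M(\emptyset)=0\}$ and $\overline{\mathrm{GARI}}(\Gamma)=\{M: M(\emptyset)=1\}$. The map $\exp_\times:\overline{\mathrm{ARI}}(\Gamma)\to\overline{\mathrm{GARI}}(\Gamma)$ is $\exp_\times(A)=\sum_{k\ge0}\frac1{k!}A^{\times k}$, where $A^{\times k}$ is the $k$-fold $\times$-power, $A^{\times 0}=I$ (the sum is finite in each depth $m$). Words. $V_{\mathbb Z}$ is the set of letters $\binom{\sigma}{v}$ with $\sigma\in\Gamma$ and $v$ a $\mathbb{Z}$-linear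 combination of $v_1,v_2,\dots$; $V_{\mathbb Z}^\bullet$ is the free monoid on $V_{\mathbb Z}$ with empty word $\emptyset$. For a word $\alpha=(\binom{\sigma_1}{w_1},\dots,\binom{\sigma_m}{w_m})$, $M(\alpha):=M_{\sigma_1,\dots,\sigma_m}(w_1,\dots,w_m)$ (only used when $w_1,\dots,w_m$ are linearly independent). Write $\omega_i=\binom{\sigma_i}{v_i}$ and $\mathbf v_r=(\omega_1,\dots,\omega_r)$, $\mathbf v_0=\emptyset$. Let $\mathcal K=\mathbb{Q}(v_i\mid i\ge1)$. Shuffles. On $\mathcal A_V=\mathcal K\langle V_{\mathbb Z}\rangle$ (the $\mathcal K$-span of $V_{\mathbb Z}^\bullet$) define $\mathcal K$-bilinear products with unit $\emptyset$: $a\omega\sqcup\!\sqcup b\eta=a(\omega\sqcup\!\sqcup b\eta)+b(a\omega\sqcup\!\sqcup\eta)$ for letters $a,b$ and words $\omega,\eta$; and, for $v\ne v'$, $\binom{\sigma}{v}\omega\sqcup\!\sqcup_*\binom{\sigma'}{v'}\eta=\binom{\sigma}{v}(\omega\sqcup\!\sqcup_*\binom{\sigma'}{v'}\eta)+\binom{\sigma'}{v'}(\binom{\sigma}{v}\omega\sqcup\!\sqcup_*\eta)+\frac1{v-v'}\{\binom{\sigma\sigma'}{v}(\omega\sqcup\!\sqcup_*\eta)-\binom{\sigma\sigma'}{v'}(\omega\sqcup\!\sqcup_*\eta)\}$, the product being $0$ if $v=v'$. Let $\mathrm{Sh}\binom{\omega;\eta}{\alpha}$ and $\mathrm{Sh}_*\binom{\omega;\eta}{\alpha}$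 be the coefficients of the word $\alpha$ in $\omega\sqcup\!\sqcup\eta$ and $\omega\sqcup\!\sqcup_*\eta$. Symmetry types. $M\in\overline{\mathrm{ARI}}(\Gamma)$ (resp. $M\in\overline{\mathrm{GARI}}(\Gamma)$) is alternal (resp. symmetral) if for all $p,q\ge1$ and all $\sigma_i\in\Gamma$, with $\omega=(\omega_1,\dots,\omega_p)$, $\eta=(\omega_{p+1},\dots,\omega_{p+q})$, one has $\sum_{\alpha}\mathrm{Sh}\binom{\omega;\eta}{\alpha}M(\alpha)=0$ (resp. $=M(\omega)M(\eta)$). It is alternil (resp. symmetril) if the same holds with $\mathrm{Sh}_*$ in place of $\mathrm{Sh}$. The sets of alternal, alternil, symmetral, symmetril moulds are denoted $\overline{\mathrm{ARI}}(\Gamma)_{\mathrm{al}}$, $\overline{\mathrm{ARI}}(\Gamma)_{\mathrm{il}}$, $\overline{\mathrm{GARI}}(\Gamma)_{\mathrm{as}}$, $\overline{\mathrm{GARI}}(\Gamma)_{\mathrm{is}}$. Flexions. For nonempty words $a=(\binom{\tau_1}{y_1},\dots,\binom{\tau_k}{y_k})$, $b=(\binom{\rho_1}{z_1},\dots,\binom{\rho_l}{z_l})$: $a\rceil_b$ is $a$ with its last letter replaced by $\binom{\tau_k\rho_1\cdots\rho_l}{y_k}$, and ${}_a\lfloor b=(\binom{\rho_1}{z_1-y_k},\dots,\binom{\rho_l}{z_l-y_k})$; moreover $a\rceil_\emptyset=a$, ${}_a\lfloor\emptyset=\emptyset$. The map $\mathrm{ganit}_v(B)$. For $B\in\overline{\mathrm{GARI}}(\Gamma)$,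 the $\mathbb{Q}$-linear map $\mathrm{ganit}_v(B):\overline{\mathrm{BIMU}}(\Gamma)\to\overline{\mathrm{BIMU}}(\Gamma)$ is given by $(\mathrm{ganit}_v(B)(A))(\emptyset)=A(\emptyset)$ and, for $r\ge1$, $$(\mathrm{ganit}_v(B)(A))(\mathbf v_r)=\sum_{s\ge1}\ \sum_{\substack{\mathbf v_r=a_1b_1\cdots a_sb_s\\ a_1,\dots,a_s\ne\emptyset\\ b_1,\dots,b_{s-1}\ne\emptyset}}B({}_{a_1}\lfloor b_1)\cdots B({}_{a_s}\lfloor b_s)\,A(a_1\rceil_{b_1}\cdots a_s\rceil_{b_s}).$$ The mould $\mathrm{pic}\in\overline{\mathrm{GARI}}(\Gamma)$ is $\mathrm{pic}(\emptyset)=1$, $\mathrm{pic}(\mathbf v_m)=\frac1{v_1v_2\cdots v_m}$ for all $\sigma_i$. *)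

theory Defs
  imports Complex_Main "HOL-Library.Poly_Mapping" "HOL-Computational_Algebra.Fraction_Field"
begin

section \<open>The field of rational functions in countably many variables\<close>

text \<open>
  Variables are numbered from \<open>0\<close>: the index \<open>i\<close> stands for the variable \<open>v\<^sub>i\<^sub>+\<^sub>1\<close>.
  A polynomial is a finitely supported map from monomials (finitely supported
  exponent maps) to rational coefficients; \<open>ratfun\<close> is the field \<open>\<K>\<close> of the
  rational functions in all the variables.
\<close>

type_synonym rpoly = "(nat \<Rightarrow>\<^sub>0 nat) \<Rightarrow>\<^sub>0 rat"
type_synonym ratfun = "rpoly fract"

definition rpoly_vars :: "rpoly \<Rightarrow> nat set" where
  "rpoly_vars p = (\<Union>t\<in>Poly_Mapping.keys p. Poly_Mapping.keys t)"

text \<open>The subfield of rational functions in the first \<open>m\<close> variables; for \<open>m = 0\<close> these are the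
  rational constants.\<close>

definition ratfuns :: "nat \<Rightarrow> ratfun set" where
  "ratfuns m = {Fract a b | a b. b \<noteq> 0 \<and> rpoly_vars a \<subseteq> {..<m} \<and> rpoly_vars b \<subseteq> {..<m}}"

definition rconst :: "rat \<Rightarrow> ratfun" where
  "rconst c = Fract (Poly_Mapping.single 0 c) 1"

definition rvar :: "nat \<Rightarrow> ratfun" where
  "rvar i = Fract (Poly_Mapping.single (Poly_Mapping.single i 1) 1) 1"

definition rpoly_subst :: "(nat \<Rightarrow> ratfun) \<Rightarrow> rpoly \<Rightarrow> ratfun" where
  "rpoly_subst f p = (\<Sum>t\<in>Poly_Mapping.keys p. rconst (Poly_Mapping.lookup p t) *
     (\<Prod>i\<in>Poly_Mapping.keys t. f i ^ Poly_Mapping.lookup t i))"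

text \<open>Substitution of \<open>f i\<close> for the \<open>i\<close>-th variable in a rational function. The value is unique
  if it exists, and it exists iff some representing fraction has a denominator that is not
  annihilated by the substitution. For a member of \<open>ratfuns m\<close> this is the case
  whenever \<open>f 0, \<dots>, f (m - 1)\<close> are linearly independent linear forms.\<close>

definition ratfun_subst :: "(nat \<Rightarrow> ratfun) \<Rightarrow> ratfun \<Rightarrow> ratfun" where
  "ratfun_subst f q = (THE y. \<exists>a b. q = Fract a b \<and> rpoly_subst f b \<noteq> 0 \<and>
     y = rpoly_subst f a / rpoly_subst f b)"


section \<open>Words\<close>

text \<open>
  The group \<open>\<Gamma>\<close> is the universe of a type \<open>'g\<close> and is written additively, since the
  type classes for groups in the library are additive: \<open>\<sigma> + \<tau>\<close> is the product of \<open>\<sigma>\<close> and \<open>\<tau>\<close>.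
  An integral linear combination of the variables is its finitely supported
  family of coefficients.
\<close>

type_synonym linform = "nat \<Rightarrow>\<^sub>0 int"
type_synonym 'g letter = "'g \<times> linform"
type_synonym 'g word = "'g letter list"

definition linform_val :: "linform \<Rightarrow> ratfun" where
  "linform_val w = (\<Sum>i\<in>Poly_Mapping.keys w. of_int (Poly_Mapping.lookup w i) * rvar i)"

text \<open>The word \<open>(\<sigma>\<^sub>1, v\<^sub>1) \<dots> (\<sigma>\<^sub>m, v\<^sub>m)\<close>.\<close>

definition vword :: "'g list \<Rightarrow> 'g word" where
  "vword \<sigma> = map (\<lambda>i. (\<sigma> ! i, Poly_Mapping.single i 1)) [0..<length \<sigma>]"


section \<open>Moulds\<close>

text \<open>\<open>M [\<sigma>\<^sub>1, \<dots>, \<sigma>\<^sub>m]\<close> is the component of depth \<open>m\<close> with index \<open>(\<sigma>\<^sub>1, \<dots>, \<sigma>\<^sub>m)\<close>, as a rational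
  function of the first \<open>m\<close> variables. In particular \<open>M []\<close> is a rational constant.\<close>

type_synonym 'g mould = "'g list \<Rightarrow> ratfun"

definition BIMU :: "'g mould set" where
  "BIMU = {M. \<forall>\<sigma>. M \<sigma> \<in> ratfuns (length \<sigma>)}"

definition ARI :: "'g mould set" where
  "ARI = {M \<in> BIMU. M [] = 0}"

definition GARI :: "'g mould set" where
  "GARI = {M \<in> BIMU. M [] = 1}"

text \<open>The value \<open>M(\<alpha>)\<close> on a word; meaningful for words with linearly independent linear
  forms. The value substituted for variables beyond the depth is irrelevant.\<close>

definition mould_val :: "'g mould \<Rightarrow> 'g word \<Rightarrow> ratfun" where
  "mould_val M \<alpha> =
     ratfun_subst (\<lambda>i. if i < length \<alpha> then linform_val (snd (\<alpha> ! i)) else 0) (M (map fst \<alpha>))"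

definition mould_one :: "'g mould" where
  "mould_one \<sigma> = (if \<sigma> = [] then 1 else 0)"

definition mould_mult :: "'g mould \<Rightarrow> 'g mould \<Rightarrow> 'g mould" where
  "mould_mult A B \<sigma> =
     (\<Sum>i\<le>length \<sigma>. mould_val A (take i (vword \<sigma>)) * mould_val B (drop i (vword \<sigma>)))"

primrec mould_power :: "'g mould \<Rightarrow> nat \<Rightarrow> 'g mould" where
  "mould_power A 0 = mould_one"
| "mould_power A (Suc k) = mould_mult A (mould_power A k)"

text \<open>The sum over all \<open>k\<close> is the finite-support sum \<open>Sum_any\<close>: for \<open>A [] = 0\<close> the terms
  with \<open>k > length \<sigma>\<close> vanish.\<close>

definition mould_exp :: "'g mould \<Rightarrow> 'g mould" where
  "mould_exp A \<sigma> = (\<Sum>k. rconst (1 / fact k) * mould_power A k \<sigma>)"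


section \<open>Shuffle products\<close>

text \<open>Elements of \<open>\<K>\<langle>V\<^sub>\<int>\<rangle>\<close> are finitely supported maps from words to \<open>\<K>\<close>. Both products are
  only needed on words; on general elements they are given by bilinear extension.\<close>

type_synonym 'g word_comb = "'g word \<Rightarrow>\<^sub>0 ratfun"

definition prefix_letter :: "'g letter \<Rightarrow> 'g word_comb \<Rightarrow> 'g word_comb" where
  "prefix_letter a P =
     (\<Sum>\<alpha>\<in>Poly_Mapping.keys P. Poly_Mapping.single (a # \<alpha>) (Poly_Mapping.lookup P \<alpha>))"

definition scale_comb :: "ratfun \<Rightarrow> 'g word_comb \<Rightarrow> 'g word_comb" where
  "scale_comb c P = Poly_Mapping.map ((*) c) P"

fun shuffle :: "'g word \<Rightarrow> 'g word \<Rightarrow> 'g word_comb" where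
  "shuffle [] \<eta> = Poly_Mapping.single \<eta> 1"
| "shuffle \<omega> [] = Poly_Mapping.single \<omega> 1"
| "shuffle (a # \<omega>) (b # \<eta>) =
     prefix_letter a (shuffle \<omega> (b # \<eta>)) + prefix_letter b (shuffle (a # \<omega>) \<eta>)"

fun shuffle_star :: "'g::ab_group_add word \<Rightarrow> 'g word \<Rightarrow> 'g word_comb" where
  "shuffle_star [] \<eta> = Poly_Mapping.single \<eta> 1"
| "shuffle_star \<omega> [] = Poly_Mapping.single \<omega> 1"
| "shuffle_star ((\<sigma>, v) # \<omega>) ((\<sigma>', v') # \<eta>) =
     (if v = v' then 0
      else prefix_letter (\<sigma>, v) (shuffle_star \<omega> ((\<sigma>', v') # \<eta>))
         + prefix_letter (\<sigma>', v') (shuffle_star ((\<sigma>, v) # \<omega>) \<eta>)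
         + scale_comb (1 / linform_val (v - v'))
             (prefix_letter (\<sigma> + \<sigma>', v) (shuffle_star \<omega> \<eta>)
              - prefix_letter (\<sigma> + \<sigma>', v') (shuffle_star \<omega> \<eta>)))"

text \<open>The sum of \<open>c\<^sub>\<alpha> M(\<alpha>)\<close> over all words \<open>\<alpha>\<close>, where \<open>c\<^sub>\<alpha>\<close> is the coefficient of \<open>\<alpha>\<close> in \<open>P\<close>.\<close>

definition mould_pairing :: "'g mould \<Rightarrow> 'g word_comb \<Rightarrow> ratfun" where
  "mould_pairing M P =
     (\<Sum>\<alpha>\<in>Poly_Mapping.keys P. Poly_Mapping.lookup P \<alpha> * mould_val M \<alpha>)"


section \<open>Symmetry types\<close>

definition ARI_al :: "'g mould set" where
  "ARI_al = {M \<in> ARI. \<forall>p q \<sigma>. p \<ge> 1 \<longrightarrow> q \<ge> 1 \<longrightarrow> length \<sigma> = p + q \<longrightarrow>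
     mould_pairing M (shuffle (take p (vword \<sigma>)) (drop p (vword \<sigma>))) = 0}"

definition ARI_il :: "'g::ab_group_add mould set" where
  "ARI_il = {M \<in> ARI. \<forall>p q \<sigma>. p \<ge> 1 \<longrightarrow> q \<ge> 1 \<longrightarrow> length \<sigma> = p + q \<longrightarrow>
     mould_pairing M (shuffle_star (take p (vword \<sigma>)) (drop p (vword \<sigma>))) = 0}"

definition GARI_as :: "'g mould set" where
  "GARI_as = {M \<in> GARI. \<forall>p q \<sigma>. p \<ge> 1 \<longrightarrow> q \<ge> 1 \<longrightarrow> length \<sigma> = p + q \<longrightarrow>
     mould_pairing M (shuffle (take p (vword \<sigma>)) (drop p (vword \<sigma>)))
       = mould_val M (take p (vword \<sigma>)) * mould_val M (drop p (vword \<sigma>))}"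

definition GARI_is :: "'g::ab_group_add mould set" where
  "GARI_is = {M \<in> GARI. \<forall>p q \<sigma>. p \<ge> 1 \<longrightarrow> q \<ge> 1 \<longrightarrow> length \<sigma> = p + q \<longrightarrow>
     mould_pairing M (shuffle_star (take p (vword \<sigma>)) (drop p (vword \<sigma>)))
       = mould_val M (take p (vword \<sigma>)) * mould_val M (drop p (vword \<sigma>))}"


section \<open>Flexions and the map ganit\<close>

text \<open>\<open>flex_right a b\<close> is \<open>a\<rceil>\<^sub>b\<close> and \<open>flex_left a b\<close> is the lower flexion of \<open>b\<close> by \<open>a\<close>, for a
  nonempty word \<open>a\<close> and an arbitrary word \<open>b\<close>; for \<open>b = []\<close> they are \<open>a\<close> and \<open>[]\<close>.\<close>

definition flex_right :: "'g::ab_group_add word \<Rightarrow> 'g word \<Rightarrow> 'g word" where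
  "flex_right a b = butlast a @ [(fst (last a) + sum_list (map fst b), snd (last a))]"

definition flex_left :: "'g word \<Rightarrow> 'g word \<Rightarrow> 'g word" where
  "flex_left a b = map (\<lambda>(\<rho>, z). (\<rho>, z - snd (last a))) b"

text \<open>The list \<open>[(a\<^sub>1, b\<^sub>1), \<dots>, (a\<^sub>s, b\<^sub>s)]\<close> with \<open>s \<ge> 1\<close> encodes the factorisation
  \<open>w = a\<^sub>1 b\<^sub>1 \<cdots> a\<^sub>s b\<^sub>s\<close>; only \<open>b\<^sub>s\<close> may be empty.\<close>

definition factorisations :: "'g word \<Rightarrow> ('g word \<times> 'g word) list set" where
  "factorisations w = {ps. ps \<noteq> [] \<and> concat (map (\<lambda>(a, b). a @ b) ps) = w \<and>
     (\<forall>(a, b)\<in>set ps. a \<noteq> []) \<and> (\<forall>(a, b)\<in>set (butlast ps). b \<noteq> [])}"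

lemma finite_factorisations: "finite (factorisations w)"
proof -
  let ?W = "{u. set u \<subseteq> set w \<and> length u \<le> length w}"
  have fW: "finite ?W" by (rule finite_lists_length_le) simp
  have len: "length ps \<le> length (concat (map (\<lambda>(a, b). a @ b) ps))"
    if "\<forall>(a, b)\<in>set ps. a \<noteq> []" for ps :: "('a word \<times> 'a word) list"
    using that
  proof (induction ps)
    case (Cons p ps)
    obtain a b where p: "p = (a, b)" by (cases p)
    then have "length a \<ge> 1" using Cons.prems by (cases a) auto
    moreover have "length ps \<le> length (concat (map (\<lambda>(a, b). a @ b) ps))"
      using Cons by simp
    ultimately show ?case using p by simp
  qed simp
  have sub: "a \<in> {u. set u \<subseteq> set v \<and> length u \<le> length v} \<and>
      b \<in> {u. set u \<subseteq> set v \<and> length u \<le> length v}"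
    if ab: "(a, b) \<in> set ps" and v: "v = concat (map (\<lambda>(a, b). a @ b) ps)"
    for ps :: "('a word \<times> 'a word) list" and a b v
  proof -
    obtain xs ys where "ps = xs @ (a, b) # ys" using ab by (meson split_list)
    then show ?thesis using v by auto
  qed
  have "factorisations w \<subseteq> {ps. set ps \<subseteq> ?W \<times> ?W \<and> length ps \<le> length w}"
  proof
    fix ps assume "ps \<in> factorisations w"
    then have w: "w = concat (map (\<lambda>(a, b). a @ b) ps)" and ne: "\<forall>(a, b)\<in>set ps. a \<noteq> []"
      unfolding factorisations_def by auto
    have "set ps \<subseteq> ?W \<times> ?W" 
    proof
      fix p assume "p \<in> set ps"
      then show "p \<in> ?W \<times> ?W"
        using sub[OF _ w, of "fst p" "snd p"] by (simp add: mem_Times_iff)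
    qed
    moreover have "length ps \<le> length w" using len[OF ne] w by simp
    ultimately show "ps \<in> {ps. set ps \<subseteq> ?W \<times> ?W \<and> length ps \<le> length w}" by blast
  qed
  then show ?thesis
    by (rule finite_subset) (intro finite_lists_length_le finite_cartesian_product fW)
qed

definition ganit :: "'g::ab_group_add mould \<Rightarrow> 'g mould \<Rightarrow> 'g mould" where
  "ganit B A \<sigma> =
     (if \<sigma> = [] then A []
      else (\<Sum>ps\<in>factorisations (vword \<sigma>).
              (\<Prod>(a, b)\<leftarrow>ps. mould_val B (flex_left a b)) *
              mould_val A (concat (map (\<lambda>(a, b). flex_right a b) ps))))"

definition pic :: "'g mould" where
  "pic \<sigma> = 1 / (\<Prod>i<length \<sigma>. rvar i)"

end

theory Submission
  imports Defs
begin

text \<open>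
  A mould is regarded as a linear functional on words. In this dual picture \<open>\<times>\<close> is the convolution
  product for deconcatenation, symmetral and symmetril moulds are the characters of the shuffle and
  the quasi-shuffle algebra, and alternal and alternil moulds are their infinitesimal characters.
  The binomial formula for the powers of an infinitesimal character shows that its exponential
  is a character.

  The map \<open>ganit(pic)\<close> is the transpose of a map \<open>\<Phi>\<close> on words which cuts a word into nonempty
  blocks in all possible ways and replaces a block with variables \<open>y, z\<^sub>1, \<dots>, z\<^sub>l\<close> by one letter
  with variable \<open>y\<close> and coefficient \<open>1 / ((z\<^sub>1 - y) \<cdots> (z\<^sub>l - y))\<close>. Cutting into blocks commutes with
  deconcatenation, so \<open>ganit(pic)\<close> is multiplicative and commutes with the exponential. Moreover
  \<open>\<Phi>\<close> carries the quasi-shuffle product to the shuffle product (similarly to Hoffman's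
  isomorphism), which gives both horizontal arrows.
\<close>

section \<open>Quasi-shuffles of functionals on words\<close>

text \<open>A mould has meaningful values only on words with independent linear forms, so every
  identity has to be restricted to words with distinct variables. This is harmless because cutting,
  contracting and multiplying jointly distinct words never repeat a variable: a merged letter keeps
  one of the variables it merges. All such words are renamings of v_1 ... v_m. Hence variables can
  be plain indices, and general moulds are only ever evaluated by injective renamings, which are
  field endomorphisms; differences of variables reach only \<open>pic\<close>, whose values are
  explicit. Products are never expanded into combinations of words. The functional \<open>F\<close>
  is an argument of the recursion, and putting a letter in front of a word becomes precomposition of
  \<open>F\<close>; inductions therefore range over all functionals. The function 1/(z - y) that
  weights a letter absorbed into a block is, with its arguments exchanged, also the coefficient of
  the quasi-shuffle product.\<close>

text \<open>The value of the linear extension of \<open>F\<close> at the quasi-shuffle product of \<open>u\<close> and \<open>v\<close>: the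
  shuffle product for \<open>e = 0\<close>, the product of alternility for \<open>e i j = 1 / (v\<^sub>i - v\<^sub>j)\<close>.\<close>

fun qsh :: "('i \<Rightarrow> 'i \<Rightarrow> 'k::comm_ring_1) \<Rightarrow> (('g::ab_group_add \<times> 'i) list \<Rightarrow> 'k) \<Rightarrow>
    ('g \<times> 'i) list \<Rightarrow> ('g \<times> 'i) list \<Rightarrow> 'k" where
  "qsh e F [] v = F v"
| "qsh e F (a # u) [] = F (a # u)"
| "qsh e F (a # u) (b # v) =
     qsh e (\<lambda>w. F (a # w)) u (b # v) + qsh e (\<lambda>w. F (b # w)) (a # u) v
     + e (snd a) (snd b) *
       (qsh e (\<lambda>w. F ((fst a + fst b, snd a) # w)) u v
        - qsh e (\<lambda>w. F ((fst a + fst b, snd b) # w)) u v)"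

lemma qsh_Nil_left [simp]: "qsh e F [] = F"
  by (rule ext) simp

lemma qsh_Nil_right [simp]: "qsh e F u [] = F u"
  by (cases u) auto

lemma qsh_add: "qsh e (\<lambda>w. F w + G w) u v = qsh e F u v + qsh e G u v"
  by (induction e F u v arbitrary: G rule: qsh.induct)
    (simp, simp, simp only: qsh.simps, simp add: ring_distribs)

lemma qsh_scale: "qsh e (\<lambda>w. k * F w) u v = k * qsh e F u v"
  by (induction e F u v rule: qsh.induct) (simp_all add: algebra_simps)

lemma qsh_zero [simp]: "qsh e (\<lambda>w. 0) u v = 0"
  using qsh_scale[of e 0 "\<lambda>w. 0" u v] by simp

lemma qsh_sum: "qsh e (\<lambda>w. \<Sum>n\<in>N. F n w) u v = (\<Sum>n\<in>N. qsh e (F n) u v)"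
  by (induction N rule: infinite_finite_induct) (simp_all add: qsh_add)

definition dwords :: "'i set \<Rightarrow> ('g \<times> 'i) list set" where
  "dwords S = {w. distinct (map snd w) \<and> snd ` set w \<subseteq> S}"

lemma dwords_Cons_iff: "a # w \<in> dwords S \<longleftrightarrow> snd a \<in> S \<and> w \<in> dwords (S - {snd a})"
proof -
  have "snd a \<notin> snd ` set w \<Longrightarrow> snd ` set w \<subseteq> S \<longleftrightarrow> snd ` set w \<subseteq> S - {snd a}"
    by blast
  then show ?thesis
    by (auto simp: dwords_def)
qed

text \<open>Needed for the exponential: one truncation of the series serves for all words with
  distinct variables taken from \<open>w\<close>.\<close>

lemma dwords_length_le:
  assumes "u \<in> dwords (snd ` set w)"
  shows "length u \<le> length w"
proof -
  have "length u = card (snd ` set u)"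
    using assms by (metis (no_types, lifting) dwords_def distinct_card length_map list.set_map mem_Collect_eq)
  also have "\<dots> \<le> card (snd ` set w)"
    using assms by (intro card_mono) (auto simp: dwords_def)
  also have "\<dots> \<le> length w"
    by (metis card_length length_map list.set_map)
  finally show ?thesis .
qed

lemma dwords_append_length_le:
  fixes v w :: "('g \<times> 'i) list"
  assumes "u \<in> dwords (snd ` set v \<union> snd ` set w)"
  shows "length u \<le> length v + length w"
  using dwords_length_le[of u "v @ w"] assms by (simp add: image_Un)

text \<open>One induction for two uses. With \<open>h\<close> the identity it shows that
  \<open>qsh\<close> reads \<open>F\<close> only at words with distinct variables among those of
  \<open>u\<close> and \<open>v\<close>; with \<open>h\<close> a renaming it carries identities from
  v_1 ... v_m to other words.\<close>

lemma qsh_equivariant: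
  fixes h :: "'k::comm_ring_1 \<Rightarrow> 'l::comm_ring_1" and r :: "'i \<Rightarrow> 'j"
  assumes add: "\<And>x y. h (x + y) = h x + h y" and mult: "\<And>x y. h (x * y) = h x * h y"
    and e: "\<And>i j. h (e i j) = e' (r i) (r j)"
    and F: "\<And>w. w \<in> dwords (snd ` set u \<union> snd ` set v) \<Longrightarrow> h (F w) = G (map (apsnd r) w)"
    and "distinct (map snd (u @ v))"
  shows "h (qsh e F u v) = qsh e' G (map (apsnd r) u) (map (apsnd r) v)"
proof -
  have diff: "h (x - y) = h x - h y" for x y
    using add[of "x - y" y] by simp
  show ?thesis
    using e F \<open>distinct _\<close>
  proof (induction e F u v arbitrary: G rule: qsh.induct[case_names N1 N2 CC])
    case (N1 e F v)
    then show ?case by (simp add: dwords_def)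
  next
    case (N2 e F a u)
    then show ?case by (simp add: dwords_def)
  next
    case (CC e F a u b v)
    have step: "h (F (c # w)) = G (apsnd r c # map (apsnd r) w)"
      if "w \<in> dwords S" "snd c \<notin> S" "S \<union> {snd c} \<subseteq> snd ` set (a # u) \<union> snd ` set (b # v)" for c w S
      using CC.prems(2)[of "c # w"] that by (auto simp: dwords_def)
    note step_pair = step[of _ _ "(_, _)", simplified]
    have 1: "h (qsh e (\<lambda>w. F (a # w)) u (b # v)) =
        qsh e' (\<lambda>w. G (apsnd r a # w)) (map (apsnd r) u) (map (apsnd r) (b # v))"
      using CC.prems(3) by (intro CC.IH(1) CC.prems(1); (intro step)?) auto
    have 2: "h (qsh e (\<lambda>w. F (b # w)) (a # u) v) =
        qsh e' (\<lambda>w. G (apsnd r b # w)) (map (apsnd r) (a # u)) (map (apsnd r) v)"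
      using CC.prems(3) by (intro CC.IH(2) CC.prems(1); (intro step)?) auto
    have 3: "h (qsh e (\<lambda>w. F ((fst a + fst b, snd a) # w)) u v) =
        qsh e' (\<lambda>w. G ((fst a + fst b, r (snd a)) # w)) (map (apsnd r) u) (map (apsnd r) v)"
      using CC.prems(3) by (intro CC.IH(3) CC.prems(1); (intro step_pair)?) auto
    have 4: "h (qsh e (\<lambda>w. F ((fst a + fst b, snd b) # w)) u v) =
        qsh e' (\<lambda>w. G ((fst a + fst b, r (snd b)) # w)) (map (apsnd r) u) (map (apsnd r) v)"
      using CC.prems(3) by (intro CC.IH(4) CC.prems(1); (intro step_pair)?) auto
    show ?case
      using 1 2 3 4 by (simp add: add mult diff CC.prems(1))
  qed
qed

lemma qsh_cong:
  assumes "\<And>w. w \<in> dwords (snd ` set u \<union> snd ` set v) \<Longrightarrow> F w = G w"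
    and "distinct (map snd (u @ v))"
  shows "qsh e F u v = qsh e G u v"
  using qsh_equivariant[of "\<lambda>x. x" e e id u v F G] assms by simp

section \<open>Deconcatenation and convolution of functionals\<close>

lemma sum_atMost_length_Cons:
  "(\<Sum>i\<le>length (a # u). f i) = f 0 + (\<Sum>i\<le>length u. f (Suc i))"
  by (simp add: sum.atMost_Suc_shift del: sum.atMost_Suc)

text \<open>\<open>H\<close> is a functional on pairs of words, and \<open>deconc H\<close> is its
  pull-back along the deconcatenation coproduct.\<close>

definition deconc :: "('a list \<Rightarrow> 'a list \<Rightarrow> 'k::comm_monoid_add) \<Rightarrow> 'a list \<Rightarrow> 'k" where
  "deconc H w = (\<Sum>i\<le>length w. H (take i w) (drop i w))"

lemma deconc_Nil [simp]: "deconc H [] = H [] []"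
  by (simp add: deconc_def)

lemma deconc_Cons [simp]: "deconc H (a # w) = H [] (a # w) + deconc (\<lambda>u. H (a # u)) w"
  unfolding deconc_def sum_atMost_length_Cons by simp

lemma deconc_add: "deconc (\<lambda>u v. H u v + K u v) w = deconc H w + deconc K w"
  by (simp add: deconc_def sum.distrib)

lemma deconc_scale: "deconc (\<lambda>u v. k * H u v) w = k * deconc H w"
  for k :: "'k::comm_ring_1"
  by (simp add: deconc_def sum_distrib_left)

lemma deconc_diff: "deconc (\<lambda>u v. H u v - K u v) w = deconc H w - deconc K w"
  for H :: "_ \<Rightarrow> _ \<Rightarrow> 'k::comm_ring_1"
  by (simp add: deconc_def sum_subtractf)

text \<open>The bialgebra axiom, dualised to functionals.\<close>

lemma qsh_deconc:
  "qsh e (deconc H) u v =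
     deconc (\<lambda>u1 u2. deconc (\<lambda>v1 v2. qsh e (\<lambda>x. qsh e (H x) u2 v2) u1 v1) v) u"
proof (induction "length u + length v" arbitrary: u v H rule: less_induct)
  case less
  show ?case
  proof (cases u; cases v)
    fix a u' b v'
    assume uv: "u = a # u'" "v = b # v'"
    have 1: "qsh e (deconc H') u' (b # v') = deconc (\<lambda>u1 u2. deconc (\<lambda>v1 v2.
        qsh e (\<lambda>x. qsh e (H' x) u2 v2) u1 v1) (b # v')) u'" for H'
      using uv by (intro less) auto
    have 2: "qsh e (deconc H') (a # u') v' = deconc (\<lambda>u1 u2. deconc (\<lambda>v1 v2.
        qsh e (\<lambda>x. qsh e (H' x) u2 v2) u1 v1) v') (a # u')" for H'
      using uv by (intro less) auto
    have 3: "qsh e (deconc H') u' v' = deconc (\<lambda>u1 u2. deconc (\<lambda>v1 v2.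
        qsh e (\<lambda>x. qsh e (H' x) u2 v2) u1 v1) v') u'" for H'
      using uv by (intro less) auto
    \<comment> \<open>A letter put in front of the argument of \<open>deconc H\<close> splits off
      the cut before that letter. The terms split off in this way add up to
      \<open>qsh e (H []) u v\<close>, the summand with \<open>u1 = []\<close> and
      \<open>v1 = []\<close>; the remaining ones are covered by the induction hypotheses.\<close>
    show ?thesis
      unfolding uv
      by (simp add: qsh_add 1 2 3 deconc_add deconc_scale deconc_diff algebra_simps)
  qed simp_all
qed

definition conv :: "('a list \<Rightarrow> 'k::comm_ring_1) \<Rightarrow> ('a list \<Rightarrow> 'k) \<Rightarrow> 'a list \<Rightarrow> 'k" where
  "conv F G = deconc (\<lambda>u v. F u * G v)"

definition counit :: "'a list \<Rightarrow> 'k::comm_ring_1" where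
  "counit w = (if w = [] then 1 else 0)"

primrec conv_power :: "('a list \<Rightarrow> 'k::comm_ring_1) \<Rightarrow> nat \<Rightarrow> 'a list \<Rightarrow> 'k" where
  "conv_power F 0 = counit"
| "conv_power F (Suc n) = conv F (conv_power F n)"

lemma counit_simps [simp]: "counit [] = 1" "counit (a # w) = 0"
  by (simp_all add: counit_def)

lemma deconc_cong:
  "(\<And>u v. w = u @ v \<Longrightarrow> H u v = K u v) \<Longrightarrow> deconc H w = deconc K w"
  by (simp add: deconc_def)

lemma deconc_zero [simp]: "deconc (\<lambda>u v. 0) w = 0"
  by (simp add: deconc_def)

lemma deconc_sum: "deconc (\<lambda>u v. \<Sum>n\<in>N. H n u v) w = (\<Sum>n\<in>N. deconc (H n) w)"
  unfolding deconc_def by (rule sum.swap)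

lemma deconc_counit [simp]: "deconc (\<lambda>u v. counit u * G v) w = G w"
  by (cases w) simp_all

text \<open>More than \<open>length w\<close> factors force an empty piece in every cut of
  \<open>w\<close>, and \<open>F\<close> vanishes there.\<close>

lemma conv_power_eq_0:
  assumes "F [] = 0" "length w < n"
  shows "conv_power F n w = 0"
  using assms(2)
proof (induction n arbitrary: w)
  case (Suc n)
  have "F u * conv_power F n v = 0" if "w = u @ v" for u v
    using that Suc assms(1) by (cases u) auto
  then have "conv F (conv_power F n) w = deconc (\<lambda>u v. 0) w"
    unfolding conv_def by (rule deconc_cong)
  then show ?case by simp
qed simp

section \<open>Characters, infinitesimal characters and the exponential\<close>

lemma qsh_conv:
  "qsh e (conv F G) u v =
     deconc (\<lambda>u1 u2. deconc (\<lambda>v1 v2. qsh e F u1 v1 * qsh e G u2 v2) v) u"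
proof -
  have "qsh e (\<lambda>x. F x * c) u1 v1 = qsh e F u1 v1 * c" for c u1 v1
    using qsh_scale[of e c F u1 v1] by (simp add: mult.commute)
  then show ?thesis
    unfolding conv_def by (simp add: qsh_deconc qsh_scale)
qed

lemma qsh_counit: "qsh e counit u v = counit u * counit v"
  by (cases u; cases v) simp_all

text \<open>Pascal's rule in the shape of the induction step of the binomial theorem: the new factor
  raises either the first or the second exponent.\<close>

lemma sum_binomial_Suc:
  fixes X :: "nat \<Rightarrow> nat \<Rightarrow> 'k::comm_ring_1"
  shows "(\<Sum>k\<le>Suc n. of_nat (Suc n choose k) * X k (Suc n - k)) =
    (\<Sum>k\<le>n. of_nat (n choose k) * (X (Suc k) (n - k) + X k (Suc (n - k))))"
proof -
  \<comment> \<open>The term \<open>k = Suc n\<close> can be added because its binomial coefficient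
    is 0.\<close>
  have "(\<Sum>k\<le>n. of_nat (n choose k) * X k (Suc (n - k))) =
      (\<Sum>k\<le>Suc n. of_nat (n choose k) * X k (Suc n - k))"
    by (simp add: Suc_diff_le binomial_eq_0 cong: sum.cong_simp)
  also have "\<dots> = X 0 (Suc n) + (\<Sum>k\<le>n. of_nat (n choose Suc k) * X (Suc k) (n - k))"
    by (simp add: sum.atMost_Suc_shift del: sum.atMost_Suc)
  finally show ?thesis
    by (simp add: sum.atMost_Suc_shift algebra_simps sum.distrib del: sum.atMost_Suc)
qed

text \<open>Words with a repeated variable are excluded, since moulds have no meaningful values on them.\<close>

definition qprimitive ::
    "('i \<Rightarrow> 'i \<Rightarrow> 'k::comm_ring_1) \<Rightarrow> (('g::ab_group_add \<times> 'i) list \<Rightarrow> 'k) \<Rightarrow> bool" where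
  "qprimitive e F \<longleftrightarrow> (\<forall>u v. distinct (map snd (u @ v)) \<longrightarrow>
     qsh e F u v = F u * counit v + counit u * F v)"

definition qcharacter ::
    "('i \<Rightarrow> 'i \<Rightarrow> 'k::comm_ring_1) \<Rightarrow> (('g::ab_group_add \<times> 'i) list \<Rightarrow> 'k) \<Rightarrow> bool" where
  "qcharacter e F \<longleftrightarrow> (\<forall>u v. distinct (map snd (u @ v)) \<longrightarrow> qsh e F u v = F u * F v)"

text \<open>On products, a primitive \<open>F\<close> acts as the sum of \<open>F\<close> on the
  left factor and \<open>F\<close> on the right factor. These two commute under convolution on pairs
  of words, and the claim is the binomial theorem for them.\<close>

lemma qsh_conv_power:
  assumes "qprimitive e F" "distinct (map snd (u @ v))"
  shows "qsh e (conv_power F n) u v =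
    (\<Sum>k\<le>n. of_nat (n choose k) * (conv_power F k u * conv_power F (n - k) v))"
  using assms(2)
proof (induction n arbitrary: u v)
  case 0
  show ?case by (simp add: qsh_counit)
next
  case (Suc n)
  let ?P = "conv_power F"
  have "qsh e (?P (Suc n)) u v =
      deconc (\<lambda>u1 u2. deconc (\<lambda>v1 v2. qsh e F u1 v1 * qsh e (?P n) u2 v2) v) u"
    by (simp add: qsh_conv)
  also have "\<dots> = deconc (\<lambda>u1 u2. deconc (\<lambda>v1 v2. (F u1 * counit v1 + counit u1 * F v1) *
      (\<Sum>k\<le>n. of_nat (n choose k) * (?P k u2 * ?P (n - k) v2))) v) u"
  proof (intro deconc_cong arg_cong2[of _ _ _ _ "(*)"])
    fix u1 u2 v1 v2 assume "u = u1 @ u2" "v = v1 @ v2"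
    with Suc.prems have "distinct (map snd (u1 @ v1))" "distinct (map snd (u2 @ v2))"
      by auto
    then show "qsh e F u1 v1 = F u1 * counit v1 + counit u1 * F v1"
      "qsh e (?P n) u2 v2 = (\<Sum>k\<le>n. of_nat (n choose k) * (?P k u2 * ?P (n - k) v2))"
      using assms(1) Suc.IH by (auto simp: qprimitive_def)
  qed
  also have "\<dots> = (\<Sum>k\<le>n. deconc (\<lambda>u1 u2. deconc (\<lambda>v1 v2.
      of_nat (n choose k) * (F u1 * ?P k u2 * (counit v1 * ?P (n - k) v2)) +
      of_nat (n choose k) * (counit u1 * ?P k u2 * (F v1 * ?P (n - k) v2))) v) u)"
    unfolding deconc_sum[symmetric] sum_distrib_left by (simp add: algebra_simps)
  also have "\<dots> = (\<Sum>k\<le>n. of_nat (n choose k) *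
      (?P (Suc k) u * ?P (n - k) v + ?P k u * ?P (Suc (n - k)) v))"
  proof (rule sum.cong[OF refl])
    fix k
    have "deconc (\<lambda>u1 u2. F u1 * ?P k u2 * c) u = ?P (Suc k) u * c" for c
      using deconc_scale[of c "\<lambda>u1 u2. F u1 * ?P k u2" u] by (simp add: conv_def mult.commute)
    moreover have "deconc (\<lambda>u1 u2. counit u1 * ?P k u2 * c) u = ?P k u * c" for c
      using deconc_scale[of c "\<lambda>u1 u2. counit u1 * ?P k u2" u] by (simp add: mult.commute)
    ultimately show "deconc (\<lambda>u1 u2. deconc (\<lambda>v1 v2.
      of_nat (n choose k) * (F u1 * ?P k u2 * (counit v1 * ?P (n - k) v2)) +
      of_nat (n choose k) * (counit u1 * ?P k u2 * (F v1 * ?P (n - k) v2))) v) u =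
      of_nat (n choose k) * (?P (Suc k) u * ?P (n - k) v + ?P k u * ?P (Suc (n - k)) v)"
      by (simp add: deconc_add deconc_scale conv_def[of F, symmetric] distrib_left)
  qed
  also have "\<dots> = (\<Sum>k\<le>Suc n. of_nat (Suc n choose k) * (?P k u * ?P (Suc n - k) v))"
    by (simp only: sum_binomial_Suc[where X = "\<lambda>k l. ?P k u * ?P l v"])
  finally show ?case .
qed

text \<open>\<open>\<rho> k\<close> plays the role of \<open>1 / k!\<close>.\<close>

definition conv_exp :: "(nat \<Rightarrow> 'k::comm_ring_1) \<Rightarrow> ('a list \<Rightarrow> 'k) \<Rightarrow> 'a list \<Rightarrow> 'k" where
  "conv_exp \<rho> F w = (\<Sum>k\<le>length w. \<rho> k * conv_power F k w)"

lemma conv_exp_upto: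
  assumes "F [] = 0" "length w \<le> N"
  shows "conv_exp \<rho> F w = (\<Sum>k\<le>N. \<rho> k * conv_power F k w)"
  unfolding conv_exp_def using assms
  by (intro sum.mono_neutral_left) (auto simp: conv_power_eq_0)

text \<open>The exponential of a sum of two commuting elements is the product of their exponentials;
  the hypothesis on \<rho> turns the binomial sums into a Cauchy product.\<close>

lemma qcharacter_conv_exp:
  assumes prim: "qprimitive e F" and F0: "F [] = 0"
    and \<rho>: "\<And>n k. k \<le> n \<Longrightarrow> \<rho> n * of_nat (n choose k) = \<rho> k * \<rho> (n - k)"
  shows "qcharacter e (conv_exp \<rho> F)"
  unfolding qcharacter_def
proof (intro allI impI)
  fix u v :: "('c \<times> 'a) list"
  assume uv: "distinct (map snd (u @ v))"
  let ?P = "conv_power F" and ?N = "length u + length v"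
  have "qsh e (conv_exp \<rho> F) u v = qsh e (\<lambda>w. \<Sum>k\<le>?N. \<rho> k * ?P k w) u v"
    using uv F0 by (intro qsh_cong conv_exp_upto dwords_append_length_le) auto
  also have "\<dots> = (\<Sum>n\<le>?N. \<Sum>k\<le>n. \<rho> k * ?P k u * (\<rho> (n - k) * ?P (n - k) v))"
  proof -
    have "\<rho> n * (of_nat (n choose k) * (x * y)) = \<rho> k * x * (\<rho> (n - k) * y)" if "k \<le> n" for n k x y
      using arg_cong[OF \<rho>[OF that], of "\<lambda>t. t * (x * y)"] by (simp add: mult_ac)
    then show ?thesis
      by (simp add: qsh_sum qsh_scale qsh_conv_power[OF prim uv] sum_distrib_left cong: sum.cong_simp)
  qed
  also have "\<dots> = (\<Sum>(k, l)\<in>{(k, l). k + l \<le> ?N}. \<rho> k * ?P k u * (\<rho> l * ?P l v))"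
    by (simp add: sum.triangle_reindex_eq)
  \<comment> \<open>The triangle contains this rectangle, and outside the rectangle one of the
    powers exceeds the length of its word.\<close>
  also have "\<dots> = (\<Sum>(k, l)\<in>{..length u} \<times> {..length v}. \<rho> k * ?P k u * (\<rho> l * ?P l v))"
  proof (rule sum.mono_neutral_right)
    show "finite {(k, l). k + l \<le> ?N}"
      by (rule finite_subset[of _ "{..?N} \<times> {..?N}"]) auto
    have "\<rho> k * ?P k u * (\<rho> l * ?P l v) = 0" if "\<not> (k \<le> length u \<and> l \<le> length v)" for k l
      using that conv_power_eq_0[of F u k, OF F0] conv_power_eq_0[of F v l, OF F0] by auto
    then show "\<forall>p\<in>{(k, l). k + l \<le> ?N} - {..length u} \<times> {..length v}.
        (case p of (k, l) \<Rightarrow> \<rho> k * ?P k u * (\<rho> l * ?P l v)) = 0"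
      by auto
  qed auto
  also have "\<dots> = conv_exp \<rho> F u * conv_exp \<rho> F v"
    by (simp add: conv_exp_def sum_product sum.cartesian_product)
  finally show "qsh e (conv_exp \<rho> F) u v = conv_exp \<rho> F u * conv_exp \<rho> F v" .
qed

section \<open>The contraction map\<close>

definition absorb :: "'g::ab_group_add \<times> 'i \<Rightarrow> ('g \<times> 'i) list \<Rightarrow> 'g \<times> 'i" where
  "absorb a u = (fst a + sum_list (map fst u), snd a)"

definition weight :: "('i \<Rightarrow> 'i \<Rightarrow> 'k::comm_ring_1) \<Rightarrow> 'i \<Rightarrow> ('g \<times> 'i) list \<Rightarrow> 'k" where
  "weight c i u = (\<Prod>b\<leftarrow>u. c i (snd b))"

lemma absorb_simps [simp]:
  "absorb a [] = a" "snd (absorb a u) = snd a"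
  by (simp_all add: absorb_def)

lemma weight_simps [simp]:
  "weight c i [] = 1" "weight c i (b # u) = c i (snd b) * weight c i u"
  by (simp_all add: weight_def)

lemma apsnd_absorb: "apsnd r (absorb a u) = absorb (apsnd r a) (map (apsnd r) u)"
  by (simp add: absorb_def apsnd_def map_prod_def split_beta comp_def)

text \<open>A term of \<open>ganit\<close> corresponds to a cut of the word into nonempty blocks: each block
  consists of the last letter of some \<open>a\<^sub>i\<close> followed by \<open>b\<^sub>i\<close>, or of a single other letter of
  some \<open>a\<^sub>i\<close>. The first letter of a block absorbs the group elements of its other letters.\<close>

fun contr :: "('i \<Rightarrow> 'i \<Rightarrow> 'k::comm_ring_1) \<Rightarrow> (('g::ab_group_add \<times> 'i) list \<Rightarrow> 'k) \<Rightarrow>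
    ('g \<times> 'i) list \<Rightarrow> 'k" where
  "contr c F [] = F []"
| "contr c F (a # w) = (\<Sum>i\<le>length w. weight c (snd a) (take i w) *
     contr c (\<lambda>t. F (absorb a (take i w) # t)) (drop i w))"

lemma contr_Cons:
  "contr c F (a # w) =
     deconc (\<lambda>u v. weight c (snd a) u * contr c (\<lambda>t. F (absorb a u # t)) v) w"
  by (simp add: deconc_def)

declare contr.simps(2) [simp del]

text \<open>Contraction of a nonempty word yields nonempty words only, so the functionals may differ
  at \<open>[]\<close>. This licenses \<open>hd\<close> and \<open>tl\<close> in
  \<open>qsh_contr\<close>.\<close>

lemma contr_Cons_cong:
  assumes "\<And>a w. F (a # w) = G (a # w)"
  shows "contr c F (a # w) = contr c G (a # w)"
  by (simp add: contr_Cons assms)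

lemma contr_add: "contr c (\<lambda>w. F w + G w) w = contr c F w + contr c G w"
  by (induction c F w arbitrary: G rule: contr.induct)
    (simp_all add: contr.simps(2) distrib_left sum.distrib)

lemma contr_scale: "contr c (\<lambda>w. k * F w) w = k * contr c F w"
  by (induction c F w rule: contr.induct)
    (simp_all add: contr.simps(2) sum_distrib_left mult.left_commute)

lemma contr_zero [simp]: "contr c (\<lambda>w. 0) w = 0"
  using contr_scale[of c 0 "\<lambda>w. 0" w] by simp

lemma contr_sum: "contr c (\<lambda>w. \<Sum>n\<in>N. F n w) w = (\<Sum>n\<in>N. contr c (F n) w)"
  by (induction N rule: infinite_finite_induct) (simp_all add: contr_add)

lemma contr_swap:
  "contr c (\<lambda>u. contr c (\<lambda>v. K u v) y) x = contr c (\<lambda>v. contr c (\<lambda>u. K u v) x) y"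
proof (induction "length x" arbitrary: x K rule: less_induct)
  case less
  show ?case
  proof (cases x)
    case (Cons a w)
    have "contr c (\<lambda>u. contr c (\<lambda>v. K (absorb a (take i w) # u) v) y) (drop i w) =
      contr c (\<lambda>v. contr c (\<lambda>u. K (absorb a (take i w) # u) v) (drop i w)) y" for i
      using Cons by (intro less) simp
    then show ?thesis
      by (simp add: Cons contr.simps(2) contr_sum contr_scale)
  qed simp
qed

lemma contr_counit [simp]: "contr c counit w = counit w"
  by (cases w) (simp_all add: contr_Cons)

lemma deconc_assoc:
  "deconc (\<lambda>u v. deconc (\<lambda>v1 v2. H u v1 v2) v) w = deconc (\<lambda>u v. deconc (\<lambda>u1 u2. H u1 u2 v) u) w"
  by (induction w arbitrary: H) (simp_all add: deconc_add add.assoc)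

text \<open>Cutting a word into blocks and then cutting between two blocks is the same as cutting
  the word in two and then both parts into blocks.\<close>

lemma contr_conv: "contr c (conv F G) w = conv (contr c F) (contr c G) w"
proof (induction "length w" arbitrary: w F rule: less_induct)
  case less
  show ?case
  proof (cases w)
    case (Cons a v)
    let ?A = "\<lambda>x t. F (absorb a x # t)"
    have IH: "contr c (conv (?A x) G) y = conv (contr c (?A x)) (contr c G) y" if "v = x @ y" for x y
      using that Cons by (intro less) simp
    \<comment> \<open>The term with \<open>F []\<close> is the cut before the first block; in all
      others that block belongs to the left part.\<close>
    have "contr c (\<lambda>t. conv F G (absorb a x # t)) y =
        F [] * contr c (\<lambda>t. G (absorb a x # t)) y + contr c (conv (?A x) G) y" for x y
      by (simp add: conv_def contr_add contr_scale)
    then have "contr c (conv F G) w =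
        deconc (\<lambda>x y. F [] * (weight c (snd a) x * contr c (\<lambda>t. G (absorb a x # t)) y) +
          weight c (snd a) x * contr c (conv (?A x) G) y) v"
      by (simp add: Cons contr_Cons algebra_simps)
    also have "\<dots> = F [] * contr c G w + deconc (\<lambda>x y. weight c (snd a) x * contr c (conv (?A x) G) y) v"
      by (simp add: deconc_add deconc_scale Cons contr_Cons)
    also have "deconc (\<lambda>x y. weight c (snd a) x * contr c (conv (?A x) G) y) v =
        deconc (\<lambda>x y. deconc (\<lambda>y1 y2. weight c (snd a) x * contr c (?A x) y1 * contr c G y2) y) v"
      by (intro deconc_cong, subst IH) (auto simp: conv_def deconc_scale mult.assoc)
    \<comment> \<open>Coassociativity reunites the first block with the rest of the left
      part.\<close>
    also have "\<dots> = deconc (\<lambda>x y. contr c F (a # x) * contr c G y) v"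
      unfolding deconc_assoc
      by (intro deconc_cong) (simp add: contr_Cons deconc_def sum_distrib_right)
    finally show ?thesis
      by (simp add: Cons conv_def)
  qed (simp add: conv_def)
qed

lemma contr_conv_power: "contr c (conv_power F n) w = conv_power (contr c F) n w"
proof (induction n arbitrary: w)
  case (Suc n)
  then have "contr c (conv_power F n) = conv_power (contr c F) n" by blast
  then show ?case by (simp add: contr_conv)
qed simp

lemma contr_equivariant:
  fixes h :: "'k::comm_ring_1 \<Rightarrow> 'l::comm_ring_1" and r :: "'i \<Rightarrow> 'j"
  assumes hom: "\<And>x y. h (x + y) = h x + h y" "\<And>x y. h (x * y) = h x * h y" "h 1 = 1"
    and c: "\<And>i j. i \<in> snd ` set w \<Longrightarrow> j \<in> snd ` set w \<Longrightarrow> h (c i j) = c' (r i) (r j)"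
    and F: "\<And>u. u \<in> dwords (snd ` set w) \<Longrightarrow> h (F u) = G (map (apsnd r) u)"
    and "distinct (map snd w)"
  shows "h (contr c F w) = contr c' G (map (apsnd r) w)"
proof -
  have h0: "h 0 = 0" using hom(1)[of 0 0] by simp
  have h_sum: "h (sum f I) = (\<Sum>i\<in>I. h (f i))" for f :: "nat \<Rightarrow> 'k" and I
    by (induction I rule: infinite_finite_induct) (simp_all add: h0 hom)
  show ?thesis
    using c F \<open>distinct _\<close>
  proof (induction "length w" arbitrary: w F G rule: less_induct)
    case less
    show ?case
    proof (cases w)
      case Nil
      then show ?thesis using less.prems(2)[of "[]"] by (simp add: dwords_def)
    next
      case (Cons a v)
      have "h (weight c (snd a) x * contr c (\<lambda>t. F (absorb a x # t)) y) =
          weight c' (snd (apsnd r a)) (map (apsnd r) x) *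
          contr c' (\<lambda>t. G (absorb (apsnd r a) (map (apsnd r) x) # t)) (map (apsnd r) y)"
        if v: "v = x @ y" for x y
      proof -
        have "h (F (absorb a x # u)) = G (map (apsnd r) (absorb a x # u))" if "u \<in> dwords (snd ` set y)" for u
          using less.prems(3) that Cons v
          by (intro less.prems(2)) (auto simp: dwords_def)
        then have "h (contr c (\<lambda>t. F (absorb a x # t)) y) =
            contr c' (\<lambda>t. G (absorb (apsnd r a) (map (apsnd r) x) # t)) (map (apsnd r) y)"
          using less.prems(1,3) Cons v by (intro less.hyps) (auto simp: apsnd_absorb)
        moreover have "h (weight c (snd a) x) = weight c' (r (snd a)) (map (apsnd r) x)"
        proof -
          have hc: "h (c (snd a) (snd b)) = c' (r (snd a)) (r (snd b))" if "b \<in> set w" for b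
            using that Cons by (intro less.prems(1)) auto
          have "h (weight c (snd a) p) = weight c' (r (snd a)) (map (apsnd r) p)"
            if "set p \<subseteq> set w" for p
            using that by (induction p) (simp_all add: hom hc)
          then show ?thesis using Cons v by auto
        qed
        ultimately show ?thesis
          using Cons v by (simp add: hom)
      qed
      from this[OF append_take_drop_id[symmetric]] show ?thesis
        by (simp add: Cons contr.simps(2) h_sum take_map drop_map)
    qed
  qed
qed

lemma contr_cong:
  assumes "\<And>u. u \<in> dwords (snd ` set w) \<Longrightarrow> F u = G u" and "distinct (map snd w)"
  shows "contr c F w = contr c G w"
  using contr_equivariant[of "\<lambda>x. x" w c c id F G] assms by simp

lemma contr_conv_exp:
  assumes "F [] = 0" "distinct (map snd w)"
  shows "contr c (conv_exp \<rho> F) w = conv_exp \<rho> (contr c F) w"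
proof -
  have "contr c (conv_exp \<rho> F) w = contr c (\<lambda>u. \<Sum>k\<le>length w. \<rho> k * conv_power F k u) w"
    using assms by (intro contr_cong conv_exp_upto dwords_length_le)
  then show ?thesis
    by (simp add: contr_sum contr_scale contr_conv_power conv_exp_def)
qed

section \<open>Partial fractions and the passage from shuffle to quasi-shuffle\<close>

definition recip :: "('i \<Rightarrow> 'k::field) \<Rightarrow> 'i \<Rightarrow> 'i \<Rightarrow> 'k" where
  "recip x i j = 1 / (x j - x i)"

text \<open>The reason for the coefficient 1/(v - v') in the quasi-shuffle product: in
  \<open>qsh_weight\<close> the two contraction terms together cancel exactly one of the two equal
  shuffle terms.\<close>

lemma recip_partial_fraction:
  assumes "x i \<noteq> x j" "x i \<noteq> x k" "x j \<noteq> x k"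
  shows "recip x k j * (recip x i j - recip x i k) = - (recip x i j * recip x i k)"
  using assms by (simp add: recip_def divide_simps)

lemma recip_swap: "recip x j i = - recip x i j"
  unfolding recip_def by (metis minus_diff_eq minus_divide_right)

text \<open>Shifted by \<open>x\<^sub>i\<close>, the mould \<open>pic\<close> is a character of the quasi-shuffle algebra, because of
  the partial fraction expansion of \<open>1 / ((x\<^sub>j - x\<^sub>i) (x\<^sub>k - x\<^sub>i))\<close>.\<close>

lemma qsh_weight:
  fixes x :: "'i \<Rightarrow> 'k::field"
  assumes "inj x" "distinct (map snd (u @ v))" "i \<notin> snd ` set u \<union> snd ` set v"
  shows "qsh (\<lambda>i j. recip x j i) (\<lambda>w. weight (recip x) i w * R (sum_list (map fst w))) u v =
    weight (recip x) i (u @ v) * R (sum_list (map fst (u @ v)))"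
  using assms(2,3)
proof (induction "length u + length v" arbitrary: u v R rule: less_induct)
  case less
  let ?e = "\<lambda>i j. recip x j i" and ?c = "recip x i"
  show ?case
  proof (cases u; cases v)
    fix a u' b v'
    assume uv: "u = a # u'" "v = b # v'"
    \<comment> \<open>All words of a quasi-shuffle have the same product of group elements.
      \<open>R\<close> records the dependence on it, and a letter put in front translates
      \<open>R\<close>, so the induction ranges over all \<open>R\<close>.\<close>
    have *: "qsh ?e (\<lambda>w. weight (recip x) i w * R (g + sum_list (map fst w))) p q =
        weight (recip x) i (p @ q) * R (g + sum_list (map fst (p @ q)))"
      if "length p + length q < length u + length v" "set p \<union> set q \<subseteq> set u \<union> set v"
        "distinct (map snd (p @ q))" for p q g
      using that less.prems(2) by (intro less.hyps) auto
    have **: "qsh ?e (\<lambda>w. k * weight (recip x) i w * R (g + sum_list (map fst w))) p q =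
        k * weight (recip x) i (p @ q) * R (g + sum_list (map fst (p @ q)))"
      if "length p + length q < length u + length v" "set p \<union> set q \<subseteq> set u \<union> set v"
        "distinct (map snd (p @ q))" for p q g k
      using *[OF that] qsh_scale[of ?e k "\<lambda>w. weight (recip x) i w * R (g + sum_list (map fst w))" p q]
      by (simp add: mult.assoc)
    let ?W = "weight (recip x) i (u' @ v') * R (sum_list (map fst (u @ v)))"
    let ?a = "?c (snd a)" and ?b = "?c (snd b)"
    have W: "weight (recip x) i (p @ q) = weight (recip x) i p * weight (recip x) i q"
      for p q :: "('b \<times> 'i) list"
      by (simp add: weight_def)
    let ?F = "\<lambda>w. weight (recip x) i w * R (sum_list (map fst w))"
    have "qsh ?e (\<lambda>w. ?F (a # w)) u' v = ?a * ?b * ?W"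
      using **[of u' v ?a "fst a"] less.prems(1) by (auto simp: uv W mult_ac add_ac)
    moreover have "qsh ?e (\<lambda>w. ?F (b # w)) u v' = ?a * ?b * ?W"
      using **[of u v' ?b "fst b"] less.prems(1) by (auto simp: uv W mult_ac add_ac)
    moreover have "qsh ?e (\<lambda>w. ?F ((fst a + fst b, snd a) # w)) u' v' = ?a * ?W"
      using **[of u' v' ?a "fst a + fst b"] less.prems(1) by (auto simp: uv W mult_ac add_ac)
    moreover have "qsh ?e (\<lambda>w. ?F ((fst a + fst b, snd b) # w)) u' v' = ?b * ?W"
      using **[of u' v' ?b "fst a + fst b"] less.prems(1) by (auto simp: uv W mult_ac add_ac)
    ultimately have "qsh ?e ?F u v =
       ?a * ?b * ?W + ?a * ?b * ?W + recip x (snd b) (snd a) * (?a - ?b) * ?W"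
      by (simp only: uv qsh.simps ring_distribs mult.assoc)
    also have "recip x (snd b) (snd a) * (?a - ?b) = - (?a * ?b)"
      using less.prems uv assms(1) by (intro recip_partial_fraction) (auto simp: inj_eq)
    finally show ?thesis
      by (simp add: uv W algebra_simps)
  qed simp_all
qed

text \<open>Contractions of \<open>u\<close> and of \<open>v\<close> lie in these two sets, so a
  property of \<open>F\<close> on jointly distinct pairs applies to every pair of contracted
  words.\<close>

lemma dwords_distinct_append:
  assumes "distinct (map snd (u @ v))" "p \<in> dwords (snd ` set u)" "q \<in> dwords (snd ` set v)"
  shows "distinct (map snd (p @ q))"
proof -
  have "snd ` set p \<inter> snd ` set q = {}"
    using assms unfolding dwords_def by auto
  then show ?thesis
    using assms by (simp add: dwords_def)
qed

text \<open>By \<open>qsh_deconc\<close> and \<open>qsh_weight\<close>, both sides are sums over the first block of the result. The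
  terms from the contraction of the first letters \<open>a\<close> and \<open>b\<close> cancel against those where a first block of the word
  starting with \<open>a\<close> contains \<open>b\<close>, or vice versa, as \<open>recip x\<close> is antisymmetric.\<close>

theorem qsh_contr:
  fixes x :: "'i \<Rightarrow> 'k::field" and F :: "('g::ab_group_add \<times> 'i) list \<Rightarrow> 'k"
  assumes "inj x" "distinct (map snd (u @ v))"
  shows "qsh (\<lambda>i j. recip x j i) (contr (recip x) F) u v =
    contr (recip x) (\<lambda>u'. contr (recip x) (\<lambda>v'. qsh (\<lambda>i j. 0) F u' v') v) u"
  using assms(2)
proof (induction "length u + length v" arbitrary: u v F rule: less_induct)
  case less
  let ?c = "recip x" and ?sh = "qsh (\<lambda>i j. 0)"
  let ?star = "qsh (\<lambda>i j. recip x j i)"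
  define P where "P F u v = contr ?c (\<lambda>u'. contr ?c (\<lambda>v'. ?sh F u' v') v) u"
    for F :: "('g \<times> 'i) list \<Rightarrow> 'k" and u v
  \<comment> \<open>Collects the results whose first block is headed by \<open>a\<close> and absorbs
    a prefix of each word; the quasi-shuffles of the two prefixes collapse to the weight of their
    concatenation by \<open>qsh_weight\<close>.\<close>
  define S where "S F a u v = deconc (\<lambda>u1 u2. deconc (\<lambda>v1 v2.
      weight ?c (snd a) (u1 @ v1) * P (\<lambda>t. F (absorb a (u1 @ v1) # t)) u2 v2) v) u"
    for F :: "('g \<times> 'i) list \<Rightarrow> 'k" and a u v
  show ?case
  proof (cases u; cases v)
    fix a u' b v'
    assume uv: "u = a # u'" "v = b # v'"
    have star_Cons: "?star (\<lambda>w. contr ?c F (d # w)) p q = S F d p q"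
      if "length p + length q < length u + length v" "distinct (map snd (p @ q))"
        "snd d \<notin> snd ` set p \<union> snd ` set q" for d F
          and p q :: "('g \<times> 'i) list"
      unfolding contr_Cons qsh_deconc S_def
    proof (intro deconc_cong)
      fix p1 p2 q1 q2 assume pq: "p = p1 @ p2" "q = q1 @ q2"
      have "?star (contr ?c G) p2 q2 = P G p2 q2" for G
        unfolding P_def using pq that by (intro less.hyps) auto
      then have "?star (\<lambda>w. ?star (\<lambda>t. weight ?c (snd d) w *
            contr ?c (\<lambda>t. F (absorb d w # t)) t) p2 q2) p1 q1 =
          ?star (\<lambda>w. weight ?c (snd d) w *
            (\<lambda>s. P (\<lambda>t. F ((fst d + s, snd d) # t)) p2 q2) (sum_list (map fst w))) p1 q1"
        by (simp add: qsh_scale absorb_def)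
      also have "\<dots> = weight ?c (snd d) (p1 @ q1) *
          (\<lambda>s. P (\<lambda>t. F ((fst d + s, snd d) # t)) p2 q2) (sum_list (map fst (p1 @ q1)))"
        using pq that by (intro qsh_weight assms(1)) auto
      finally show "?star (\<lambda>w. ?star (\<lambda>t. weight ?c (snd d) w *
            contr ?c (\<lambda>t. F (absorb d w # t)) t) p2 q2) p1 q1 =
          weight ?c (snd d) (p1 @ q1) * P (\<lambda>t. F (absorb d (p1 @ q1) # t)) p2 q2"
        by (simp add: absorb_def)
    qed
    have absorb_step: "absorb a (p @ b # q) = absorb (fst a + fst b, snd a) (p @ q)"
      "absorb b (a # p) = absorb (fst a + fst b, snd b) p" for p q
      by (simp_all add: absorb_def add_ac)
    have weight_append: "weight ?c i (p @ q) = weight ?c i p * weight ?c i q" for i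
      and p q :: "('g \<times> 'i) list"
      by (simp add: weight_def)
    \<comment> \<open>\<open>X\<close> is the part of \<open>S F a u' (b # v')\<close> whose first
      block takes nothing from \<open>v\<close>. In the other part \<open>b\<close> is absorbed,
      which costs the factor \<open>?c (snd a) (snd b)\<close>.\<close>
    define X where
      "X = deconc (\<lambda>u1 u2. weight ?c (snd a) u1 * P (\<lambda>t. F (absorb a u1 # t)) u2 (b # v')) u'"
    define Y where
      "Y = deconc (\<lambda>v1 v2. weight ?c (snd b) v1 * P (\<lambda>t. F (absorb b v1 # t)) (a # u') v2) v'"
    let ?Sa = "S F (fst a + fst b, snd a) u' v'" and ?Sb = "S F (fst a + fst b, snd b) u' v'"
    have Sa: "S F a u' (b # v') = X + ?c (snd a) (snd b) * ?Sa"
      unfolding S_def X_def by (simp add: deconc_add absorb_step weight_append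
          mult_ac flip: deconc_scale)
    have Sb: "S F b (a # u') v' = Y + ?c (snd b) (snd a) * ?Sb"
      unfolding S_def Y_def by (simp add: deconc_add absorb_step weight_append
          mult_ac flip: deconc_scale)
    have "?star (contr ?c F) u v =
        S F a u' (b # v') + S F b (a # u') v' + ?c (snd b) (snd a) * (?Sa - ?Sb)"
      using less.prems by (auto simp: uv star_Cons)
    also have "\<dots> = X + Y"
      by (simp add: Sa Sb recip_swap[of x "snd b" "snd a"] algebra_simps)
    also have "\<dots> = P F u v"
    proof -
      \<comment> \<open>The first letter of a shuffle of contracted words comes from one of the two.
        \<open>hd\<close> and \<open>tl\<close> express both cases as functionals of the whole
        contracted words; the values at \<open>[]\<close> do not matter.\<close>
      let ?K1 = "\<lambda>p q. ?sh (\<lambda>t. F (hd p # t)) (tl p) q"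
      let ?K2 = "\<lambda>p q. ?sh (\<lambda>t. F (hd q # t)) p (tl q)"
      have "P F u v = contr ?c (\<lambda>p. contr ?c (\<lambda>q. ?K1 p q + ?K2 p q) (b # v')) (a # u')"
        unfolding P_def uv by (intro contr_Cons_cong) simp
      also have "\<dots> = contr ?c (\<lambda>p. contr ?c (\<lambda>q. ?K1 p q) (b # v')) (a # u') +
          contr ?c (\<lambda>q. contr ?c (\<lambda>p. ?K2 p q) (a # u')) (b # v')"
        by (simp add: contr_add contr_swap[of _ "\<lambda>p q. ?K2 p q"])
      also have "contr ?c (\<lambda>p. contr ?c (\<lambda>q. ?K1 p q) (b # v')) (a # u') = X"
        by (subst contr_Cons) (simp add: X_def P_def)
      also have "contr ?c (\<lambda>q. contr ?c (\<lambda>p. ?K2 p q) (a # u')) (b # v') = Y"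
        by (subst contr_Cons) (simp add: Y_def P_def contr_swap[of _ _ "a # u'"])
      finally show ?thesis by simp
    qed
    finally show ?thesis by (simp add: P_def)
  qed simp_all
qed

lemma qcharacter_contr:
  fixes x :: "'i \<Rightarrow> 'k::field" and F :: "('g::ab_group_add \<times> 'i) list \<Rightarrow> 'k"
  assumes "inj x" "qcharacter (\<lambda>i j. 0) F"
  shows "qcharacter (\<lambda>i j. recip x j i) (contr (recip x) F)"
  unfolding qcharacter_def
proof (intro allI impI)
  fix u v :: "('g \<times> 'i) list"
  assume uv: "distinct (map snd (u @ v))"
  then have uv': "distinct (map snd u)" "distinct (map snd v)"
    by simp_all
  let ?c = "recip x"
  have "qsh (\<lambda>i j. recip x j i) (contr ?c F) u v =
      contr ?c (\<lambda>u'. contr ?c (\<lambda>v'. F u' * F v') v) u"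
    unfolding qsh_contr[OF assms(1) uv] using assms(2)[unfolded qcharacter_def] uv'
    by (intro contr_cong) (auto dest: dwords_distinct_append[OF uv] simp del: map_append)
  also have "\<dots> = contr ?c F u * contr ?c F v"
    using contr_scale[of ?c "contr ?c F v" F u] by (simp add: contr_scale mult.commute)
  finally show "qsh (\<lambda>i j. recip x j i) (contr ?c F) u v = contr ?c F u * contr ?c F v" .
qed

lemma qprimitive_contr:
  fixes x :: "'i \<Rightarrow> 'k::field" and F :: "('g::ab_group_add \<times> 'i) list \<Rightarrow> 'k"
  assumes "inj x" "qprimitive (\<lambda>i j. 0) F"
  shows "qprimitive (\<lambda>i j. recip x j i) (contr (recip x) F)"
  unfolding qprimitive_def
proof (intro allI impI)
  fix u v :: "('g \<times> 'i) list"
  assume uv: "distinct (map snd (u @ v))"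
  then have uv': "distinct (map snd u)" "distinct (map snd v)"
    by simp_all
  let ?c = "recip x"
  have *: "contr ?c (\<lambda>w. G w * k) w = contr ?c G w * k" for G k and w :: "('g \<times> 'i) list"
    using contr_scale[of ?c k G w] by (simp add: mult.commute)
  have "qsh (\<lambda>i j. recip x j i) (contr ?c F) u v =
      contr ?c (\<lambda>u'. contr ?c (\<lambda>v'. F u' * counit v' + counit u' * F v') v) u"
    unfolding qsh_contr[OF assms(1) uv] using assms(2)[unfolded qprimitive_def] uv'
    by (intro contr_cong) (auto dest: dwords_distinct_append[OF uv] simp del: map_append)
  also have "\<dots> = contr ?c F u * counit v + counit u * contr ?c F v"
    by (simp add: contr_add contr_scale *)
  finally show "qsh (\<lambda>i j. recip x j i) (contr ?c F) u v =
      contr ?c F u * counit v + counit u * contr ?c F v" .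
qed

section \<open>Substitution into rational functions\<close>

lemma rconst_0 [simp]: "rconst 0 = 0" and rconst_1 [simp]: "rconst 1 = 1"
  by (simp_all add: rconst_def Zero_fract_def One_fract_def)

lemma rconst_add: "rconst (a + b) = rconst a + rconst b"
  by (simp add: rconst_def single_add)

lemma rconst_mult: "rconst (a * b) = rconst a * rconst b"
  by (simp add: rconst_def mult_single)

lemma rconst_of_nat: "rconst (of_nat n) = of_nat n"
  by (induction n) (simp_all add: rconst_add)

lemma rconst_inverse_fact:
  assumes "k \<le> n"
  shows "rconst (1 / fact n) * of_nat (n choose k) = rconst (1 / fact k) * rconst (1 / fact (n - k))"
  using assms by (simp add: rconst_of_nat[symmetric] rconst_mult[symmetric] binomial_fact)

definition mon_val :: "(nat \<Rightarrow> 'k::comm_monoid_mult) \<Rightarrow> (nat \<Rightarrow>\<^sub>0 nat) \<Rightarrow> 'k" where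
  "mon_val f t = (\<Prod>i\<in>Poly_Mapping.keys t. f i ^ Poly_Mapping.lookup t i)"

lemma mon_val_superset:
  assumes "finite S" "Poly_Mapping.keys t \<subseteq> S"
  shows "mon_val f t = (\<Prod>i\<in>S. f i ^ Poly_Mapping.lookup t i)"
  unfolding mon_val_def using assms
  by (intro prod.mono_neutral_left) (auto simp: in_keys_iff)

lemma mon_val_0 [simp]: "mon_val f 0 = 1"
  by (simp add: mon_val_def)

lemma mon_val_single [simp]: "mon_val f (Poly_Mapping.single i n) = f i ^ n"
  by (cases "n = 0") (simp_all add: mon_val_def)

lemma mon_val_add: "mon_val f (s + t) = mon_val f s * mon_val f t"
proof -
  let ?S = "Poly_Mapping.keys s \<union> Poly_Mapping.keys t"
  have "Poly_Mapping.keys (s + t) \<subseteq> ?S"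
    by (rule keys_add)
  then show ?thesis
    by (simp add: mon_val_superset[of ?S] lookup_add power_add prod.distrib)
qed

lemma rpoly_subst_alt:
  "rpoly_subst f p = (\<Sum>t\<in>Poly_Mapping.keys p. rconst (Poly_Mapping.lookup p t) * mon_val f t)"
  by (simp add: rpoly_subst_def mon_val_def)

lemma rpoly_subst_superset:
  assumes "finite S" "Poly_Mapping.keys p \<subseteq> S"
  shows "rpoly_subst f p = (\<Sum>t\<in>S. rconst (Poly_Mapping.lookup p t) * mon_val f t)"
  unfolding rpoly_subst_alt using assms
  by (intro sum.mono_neutral_left) (auto simp: in_keys_iff)

lemma rpoly_subst_single [simp]: "rpoly_subst f (Poly_Mapping.single t c) = rconst c * mon_val f t"
  by (cases "c = 0") (simp_all add: rpoly_subst_alt)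

lemma rpoly_subst_add: "rpoly_subst f (p + q) = rpoly_subst f p + rpoly_subst f q"
proof -
  let ?S = "Poly_Mapping.keys p \<union> Poly_Mapping.keys q"
  have "Poly_Mapping.keys (p + q) \<subseteq> ?S"
    by (rule keys_add)
  then show ?thesis
    by (simp add: rpoly_subst_superset[of ?S] lookup_add rconst_add distrib_right sum.distrib)
qed

lemma rpoly_subst_0 [simp]: "rpoly_subst f 0 = 0"
  by (simp add: rpoly_subst_def)

lemma rpoly_subst_1 [simp]: "rpoly_subst f 1 = 1"
  using rpoly_subst_single[of f 0 1] by (simp del: rpoly_subst_single)

lemma rpoly_subst_sum: "rpoly_subst f (sum g I) = (\<Sum>i\<in>I. rpoly_subst f (g i))"
  by (induction I rule: infinite_finite_induct) (simp_all add: rpoly_subst_add)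

lemma rpoly_sum_monomials:
  "(\<Sum>t\<in>Poly_Mapping.keys p. Poly_Mapping.single t (Poly_Mapping.lookup p t)) = p"
  by (rule poly_mapping_eqI) (simp add: lookup_sum lookup_single when_def in_keys_iff cong: sum.cong)

lemma rpoly_subst_mult: "rpoly_subst f (p * q) = rpoly_subst f p * rpoly_subst f q"
proof -
  let ?m = "\<lambda>p t. Poly_Mapping.single t (Poly_Mapping.lookup p t)"
  have "p * q = (\<Sum>s\<in>Poly_Mapping.keys p. ?m p s) * (\<Sum>t\<in>Poly_Mapping.keys q. ?m q t)"
    by (simp add: rpoly_sum_monomials)
  also have "rpoly_subst f \<dots> = rpoly_subst f p * rpoly_subst f q"
    by (simp add: sum_product rpoly_subst_sum mult_single rconst_mult mon_val_add mult_ac)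
      (simp add: rpoly_subst_alt sum_product mult_ac)
  finally show ?thesis .
qed

lemma rpoly_subst_prod: "rpoly_subst f (prod g I) = (\<Prod>i\<in>I. rpoly_subst f (g i))"
  by (induction I rule: infinite_finite_induct) (simp_all add: rpoly_subst_mult)

text \<open>Two representatives with surviving denominators satisfy a cross-multiplied polynomial
  identity, which substitution preserves; this is the uniqueness demanded by
  \<open>THE\<close>.\<close>

lemma ratfun_subst_Fract:
  assumes "rpoly_subst f b \<noteq> 0"
  shows "ratfun_subst f (Fract a b) = rpoly_subst f a / rpoly_subst f b"
  unfolding ratfun_subst_def
proof (rule the_equality)
  fix y assume "\<exists>a' b'. Fract a b = Fract a' b' \<and> rpoly_subst f b' \<noteq> 0 \<and>
      y = rpoly_subst f a' / rpoly_subst f b'"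
  then obtain a' b' where *: "Fract a b = Fract a' b'" "rpoly_subst f b' \<noteq> 0"
      "y = rpoly_subst f a' / rpoly_subst f b'"
    by blast
  have "b \<noteq> 0" "b' \<noteq> 0" using assms * by auto
  then have "a * b' = a' * b" using * by (simp add: eq_fract)
  then have "rpoly_subst f a * rpoly_subst f b' = rpoly_subst f a' * rpoly_subst f b"
    by (metis rpoly_subst_mult)
  then show "y = rpoly_subst f a / rpoly_subst f b"
    using * assms by (metis frac_eq_eq)
qed (use assms in blast)

lemma rpoly_subst_cong:
  assumes "\<And>i. i \<in> rpoly_vars p \<Longrightarrow> f i = g i"
  shows "rpoly_subst f p = rpoly_subst g p"
  unfolding rpoly_subst_def using assms
  by (intro sum.cong prod.cong refl arg_cong2[of _ _ _ _ "(*)"] arg_cong2[of _ _ _ _ "(^)"])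
    (auto simp: rpoly_vars_def)

section \<open>Injective renamings of variables\<close>

lemma Fract_sum: "(\<Sum>i\<in>I. Fract (g i) 1) = Fract (sum g I) 1"
  by (induction I rule: infinite_finite_induct) (simp_all add: Zero_fract_def)

lemma Fract_prod: "(\<Prod>i\<in>I. Fract (g i) 1) = Fract (prod g I) 1"
  by (induction I rule: infinite_finite_induct) (simp_all add: One_fract_def)

lemma mon_val_rvar: "mon_val (rvar \<circ> k) t =
   Fract (Poly_Mapping.single (\<Sum>i\<in>Poly_Mapping.keys t. Poly_Mapping.single (k i) (Poly_Mapping.lookup t i)) 1) 1"
proof -
  have power: "rvar i ^ n = Fract (Poly_Mapping.single (Poly_Mapping.single i n) 1) 1" for i n
    by (induction n) (simp_all add: One_fract_def rvar_def mult_single single_add[symmetric])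
  have prod: "(\<Prod>i\<in>I. Poly_Mapping.single (g i) 1) = Poly_Mapping.single (sum g I) (1::rat)"
    for I and g :: "nat \<Rightarrow> nat \<Rightarrow>\<^sub>0 nat"
    by (induction I rule: infinite_finite_induct) (simp_all add: mult_single)
  show ?thesis
    by (simp add: mon_val_def power Fract_prod prod)
qed

lemma rpoly_subst_rvar: "rpoly_subst (rvar \<circ> k) p =
   Fract (\<Sum>t\<in>Poly_Mapping.keys p. Poly_Mapping.single
     (\<Sum>i\<in>Poly_Mapping.keys t. Poly_Mapping.single (k i) (Poly_Mapping.lookup t i)) (Poly_Mapping.lookup p t)) 1"
  by (simp add: rpoly_subst_alt mon_val_rvar rconst_def mult_single Fract_sum)

lemma rpoly_subst_id [simp]: "rpoly_subst rvar p = Fract p 1"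
  using rpoly_subst_rvar[of id p] by (simp add: rpoly_sum_monomials)

text \<open>Distinct monomials stay distinct, so no coefficients cancel. Hence an injective renaming
  annihilates no denominator.\<close>

lemma rpoly_subst_rvar_eq_0:
  assumes k: "inj k" and 0: "rpoly_subst (rvar \<circ> k) p = 0"
  shows "p = 0"
proof (rule ccontr)
  assume "p \<noteq> 0"
  then obtain s where s: "s \<in> Poly_Mapping.keys p" by (metis ex_in_conv keys_eq_empty)
  let ?k = "\<lambda>t. \<Sum>i\<in>Poly_Mapping.keys t. Poly_Mapping.single (k i) (Poly_Mapping.lookup t i)"
  have lookup_k: "Poly_Mapping.lookup (?k t) (k j) = Poly_Mapping.lookup t j" for t :: "nat \<Rightarrow>\<^sub>0 nat" and j
    by (simp add: lookup_sum lookup_single when_def inj_eq[OF k] in_keys_iff cong: sum.cong)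
  have inj: "?k t = ?k s \<Longrightarrow> t = s" for t
    by (rule poly_mapping_eqI) (metis lookup_k)
  have "(\<Sum>t\<in>Poly_Mapping.keys p. Poly_Mapping.single (?k t) (Poly_Mapping.lookup p t)) = 0"
    using 0 by (simp add: rpoly_subst_rvar Zero_fract_def eq_fract)
  then have "0 = (\<Sum>t\<in>Poly_Mapping.keys p. Poly_Mapping.lookup p t when ?k t = ?k s)"
    by (metis (mono_tags, lifting) lookup_sum lookup_single sum.cong lookup_zero)
  also have "\<dots> = (\<Sum>t\<in>Poly_Mapping.keys p. Poly_Mapping.lookup p t when t = s)"
    by (intro sum.cong refl) (auto simp: when_def dest: inj)
  also have "\<dots> = Poly_Mapping.lookup p s"
    using s by (simp add: when_def)
  finally show False using s by (simp add: in_keys_iff)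
qed

definition rename :: "(nat \<Rightarrow> nat) \<Rightarrow> ratfun \<Rightarrow> ratfun" where
  "rename k = ratfun_subst (rvar \<circ> k)"

lemma rename_Fract:
  assumes "inj k"
  shows "rename k (Fract a b) = rpoly_subst (rvar \<circ> k) a / rpoly_subst (rvar \<circ> k) b"
proof (cases "b = 0")
  case True
  \<comment> \<open>For \<open>b = 0\<close> the fraction equals \<open>Fract 0 1\<close>, and the
    quotient on the right is a division by zero, hence 0.\<close>
  have "rename k (Fract 0 1) = 0"
    unfolding rename_def by (subst ratfun_subst_Fract) simp_all
  then show ?thesis
    using True by (simp add: eq_fract(2))
next
  case False
  then show ?thesis
    using rpoly_subst_rvar_eq_0[OF assms, of b]
    unfolding rename_def by (intro ratfun_subst_Fract) auto
qed

lemma rename_add: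
  assumes k: "inj k" shows "rename k (p + q) = rename k p + rename k q"
proof -
  obtain a b where p: "p = Fract a b" "b \<noteq> 0" by (cases p)
  obtain c d where q: "q = Fract c d" "d \<noteq> 0" by (cases q)
  show ?thesis
    using p q rpoly_subst_rvar_eq_0[OF k, of b] rpoly_subst_rvar_eq_0[OF k, of d]
    by (simp add: rename_Fract[OF k] rpoly_subst_add rpoly_subst_mult) (metis add_frac_eq)
qed

lemma rename_mult:
  assumes k: "inj k" shows "rename k (p * q) = rename k p * rename k q"
proof -
  obtain a b where p: "p = Fract a b" "b \<noteq> 0" by (cases p)
  obtain c d where q: "q = Fract c d" "d \<noteq> 0" by (cases q)
  show ?thesis
    using p q by (simp add: rename_Fract[OF k] rpoly_subst_mult)
qed

lemma rename_rconst: "inj k \<Longrightarrow> rename k (rconst c) = rconst c"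
  by (simp add: rconst_def rename_Fract)

lemma rename_0 [simp]: "inj k \<Longrightarrow> rename k 0 = 0" and rename_1 [simp]: "inj k \<Longrightarrow> rename k 1 = 1"
  using rename_rconst[of k 0] rename_rconst[of k 1] by simp_all

lemma rename_diff: "inj k \<Longrightarrow> rename k (p - q) = rename k p - rename k q"
  using rename_add[of k "p - q" q] by simp

lemma rename_sum: "inj k \<Longrightarrow> rename k (sum g I) = (\<Sum>i\<in>I. rename k (g i))"
  by (induction I rule: infinite_finite_induct) (simp_all add: rename_add)

lemma rename_prod: "inj k \<Longrightarrow> rename k (prod g I) = (\<Prod>i\<in>I. rename k (g i))"
  by (induction I rule: infinite_finite_induct) (simp_all add: rename_mult)

lemma rename_power: "inj k \<Longrightarrow> rename k (q ^ n) = rename k q ^ n"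
  by (induction n) (simp_all add: rename_mult)

lemma rename_divide:
  assumes k: "inj k" shows "rename k (p / q) = rename k p / rename k q"
proof (cases "q = 0")
  case False
  have "rename k q \<noteq> 0"
    using rename_mult[OF k, of q "1 / q"] False k by auto
  then show ?thesis
    using rename_mult[OF k, of "p / q" q] False by (simp add: field_simps)
qed (use k in simp)

lemma rename_rvar: "inj k \<Longrightarrow> rename k (rvar i) = rvar (k i)"
  by (simp add: rvar_def[of i] rename_Fract)

lemma rename_rpoly_subst: "inj k \<Longrightarrow> rename k (rpoly_subst f p) = rpoly_subst (rename k \<circ> f) p"
  by (simp add: rpoly_subst_def rename_sum rename_mult rename_prod rename_rconst rename_power)

lemma rename_rename:
  assumes "inj k" "inj l"
  shows "rename k (rename l q) = rename (k \<circ> l) q"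
proof (cases q)
  case (Fract a b)
  have "rename k \<circ> (rvar \<circ> l) = rvar \<circ> (k \<circ> l)"
    by (simp add: fun_eq_iff rename_rvar[OF assms(1)])
  then show ?thesis
    using Fract assms by (simp add: rename_Fract inj_compose rename_divide rename_rpoly_subst)
qed

lemma rename_id: "rename id q = q"
  by (cases q) (simp add: rename_Fract)

lemma inj_rvar: "inj rvar"
  by (rule injI) (auto simp: rvar_def eq_fract dest!: arg_cong[of _ _ Poly_Mapping.keys])

text \<open>\<open>mould_val\<close> substitutes 0 beyond the depth, which is not injective. A
  member of \<open>ratfuns m\<close> does not see those variables, so a total injection can take its
  place.\<close>

lemma ratfun_subst_eq_rename:
  assumes q: "q \<in> ratfuns m" and k: "inj k" and f: "\<And>i. i < m \<Longrightarrow> f i = rvar (k i)"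
  shows "ratfun_subst f q = rename k q"
proof -
  obtain a b where ab: "q = Fract a b" "b \<noteq> 0" "rpoly_vars a \<subseteq> {..<m}" "rpoly_vars b \<subseteq> {..<m}"
    using q by (auto simp: ratfuns_def)
  have "rpoly_subst f p = rpoly_subst (rvar \<circ> k) p" if "rpoly_vars p \<subseteq> {..<m}" for p
    using that f by (intro rpoly_subst_cong) auto
  then show ?thesis
    using ab rpoly_subst_rvar_eq_0[OF k, of b] rename_Fract[OF k, of a b]
    by (metis ratfun_subst_Fract)
qed

section \<open>Closure properties of the rational functions in m variables\<close>

lemma rpoly_vars_add: "rpoly_vars (p + q) \<subseteq> rpoly_vars p \<union> rpoly_vars q"
  using keys_add[of p q] by (auto simp: rpoly_vars_def)

lemma rpoly_vars_mult: "rpoly_vars (p * q) \<subseteq> rpoly_vars p \<union> rpoly_vars q"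
proof
  fix i assume "i \<in> rpoly_vars (p * q)"
  then obtain t where t: "t \<in> Poly_Mapping.keys (p * q)" "i \<in> Poly_Mapping.keys t"
    by (auto simp: rpoly_vars_def)
  then obtain r s where "t = r + s" "r \<in> Poly_Mapping.keys p" "s \<in> Poly_Mapping.keys q"
    using keys_mult[of p q] by auto
  then show "i \<in> rpoly_vars p \<union> rpoly_vars q"
    using t keys_add[of r s] by (auto simp: rpoly_vars_def)
qed

lemma rpoly_vars_1 [simp]: "rpoly_vars 1 = {}"
  by (simp add: rpoly_vars_def flip: single_one)

lemma ratfuns_rconst: "rconst c \<in> ratfuns m"
proof -
  have "rpoly_vars (Poly_Mapping.single 0 c) = {}"
    by (auto simp: rpoly_vars_def split: if_splits)
  then show ?thesis
    unfolding ratfuns_def rconst_def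
    by (intro CollectI exI[of _ "Poly_Mapping.single 0 c"] exI[of _ 1]) simp
qed

lemma ratfuns_rvar: "i < m \<Longrightarrow> rvar i \<in> ratfuns m"
  unfolding ratfuns_def rvar_def
  by (force simp: rpoly_vars_def[of "Poly_Mapping.single _ _"])

lemma ratfuns_0 [simp]: "0 \<in> ratfuns m" and ratfuns_1 [simp]: "1 \<in> ratfuns m"
  using ratfuns_rconst[of 0 m] ratfuns_rconst[of 1 m] by simp_all

lemma ratfuns_add:
  assumes "p \<in> ratfuns m" "q \<in> ratfuns m" shows "p + q \<in> ratfuns m"
proof -
  obtain a b where p: "p = Fract a b" "b \<noteq> 0" "rpoly_vars a \<subseteq> {..<m}" "rpoly_vars b \<subseteq> {..<m}"
    using assms(1) by (auto simp: ratfuns_def)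
  obtain c d where q: "q = Fract c d" "d \<noteq> 0" "rpoly_vars c \<subseteq> {..<m}" "rpoly_vars d \<subseteq> {..<m}"
    using assms(2) by (auto simp: ratfuns_def)
  have "p + q = Fract (a * d + c * b) (b * d)" "b * d \<noteq> 0"
    using p q by simp_all
  moreover have "rpoly_vars (a * d + c * b) \<subseteq> {..<m}" "rpoly_vars (b * d) \<subseteq> {..<m}"
    using p q rpoly_vars_add[of "a * d" "c * b"] rpoly_vars_mult[of a d] rpoly_vars_mult[of c b]
      rpoly_vars_mult[of b d] by blast+
  ultimately show ?thesis unfolding ratfuns_def by blast
qed

lemma ratfuns_mult:
  assumes "p \<in> ratfuns m" "q \<in> ratfuns m" shows "p * q \<in> ratfuns m"
proof -
  obtain a b where p: "p = Fract a b" "b \<noteq> 0" "rpoly_vars a \<subseteq> {..<m}" "rpoly_vars b \<subseteq> {..<m}"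
    using assms(1) by (auto simp: ratfuns_def)
  obtain c d where q: "q = Fract c d" "d \<noteq> 0" "rpoly_vars c \<subseteq> {..<m}" "rpoly_vars d \<subseteq> {..<m}"
    using assms(2) by (auto simp: ratfuns_def)
  have "p * q = Fract (a * c) (b * d)" "b * d \<noteq> 0"
    using p q by simp_all
  moreover have "rpoly_vars (a * c) \<subseteq> {..<m}" "rpoly_vars (b * d) \<subseteq> {..<m}"
    using p q rpoly_vars_mult[of a c] rpoly_vars_mult[of b d] by blast+
  ultimately show ?thesis unfolding ratfuns_def by blast
qed

lemma ratfuns_inverse:
  assumes "q \<in> ratfuns m" shows "inverse q \<in> ratfuns m"
proof -
  obtain a b where q: "q = Fract a b" "b \<noteq> 0" "rpoly_vars a \<subseteq> {..<m}" "rpoly_vars b \<subseteq> {..<m}"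
    using assms by (auto simp: ratfuns_def)
  show ?thesis
  proof (cases "a = 0")
    case True
    then have "q = 0" using q by (simp add: Zero_fract_def eq_fract)
    then show ?thesis by simp
  next
    case False
    then show ?thesis using q by (auto simp: ratfuns_def)
  qed
qed

lemma ratfuns_divide: "p \<in> ratfuns m \<Longrightarrow> q \<in> ratfuns m \<Longrightarrow> p / q \<in> ratfuns m"
  by (simp add: divide_inverse ratfuns_mult ratfuns_inverse)

lemma ratfuns_diff:
  assumes "p \<in> ratfuns m" "q \<in> ratfuns m" shows "p - q \<in> ratfuns m"
proof -
  have "rconst (-1) = -1"
    using rconst_add[of "-1" 1] by (simp add: eq_neg_iff_add_eq_0)
  then have "p - q = p + rconst (-1) * q" by simp
  then show ?thesis
    using assms by (metis ratfuns_add ratfuns_mult ratfuns_rconst)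
qed

lemma ratfuns_sum: "(\<And>i. i \<in> I \<Longrightarrow> g i \<in> ratfuns m) \<Longrightarrow> sum g I \<in> ratfuns m"
  by (induction I rule: infinite_finite_induct) (simp_all add: ratfuns_add)

lemma ratfuns_prod: "(\<And>i. i \<in> I \<Longrightarrow> g i \<in> ratfuns m) \<Longrightarrow> prod g I \<in> ratfuns m"
  by (induction I rule: infinite_finite_induct) (simp_all add: ratfuns_mult)

lemma ratfuns_power: "q \<in> ratfuns m \<Longrightarrow> q ^ n \<in> ratfuns m"
  by (induction n) (simp_all add: ratfuns_mult)

lemma ratfuns_rename:
  assumes k: "inj k" "k ` {..<m} \<subseteq> {..<n}" and q: "q \<in> ratfuns m"
  shows "rename k q \<in> ratfuns n"
proof -
  obtain a b where q: "q = Fract a b" "b \<noteq> 0" "rpoly_vars a \<subseteq> {..<m}" "rpoly_vars b \<subseteq> {..<m}"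
    using q by (auto simp: ratfuns_def)
  have "rpoly_subst (rvar \<circ> k) p \<in> ratfuns n" if "rpoly_vars p \<subseteq> {..<m}" for p
    unfolding rpoly_subst_def using that k(2)
    by (intro ratfuns_sum ratfuns_mult ratfuns_rconst ratfuns_prod ratfuns_power)
      (auto simp: rpoly_vars_def intro!: ratfuns_rvar)
  then show ?thesis
    using q k by (simp add: rename_Fract ratfuns_divide)
qed

section \<open>Factorisations\<close>

text \<open>The remainder after a first pair \<open>([a], b)\<close> may be empty, and must then
  count as one factorisation into no pairs; \<open>factorisations\<close> contains no empty
  list.\<close>

definition factorisations0 :: "'g word \<Rightarrow> ('g word \<times> 'g word) list set" where
  "factorisations0 w = (if w = [] then {[]} else factorisations w)"

fun extend_hd :: "'a \<Rightarrow> ('a list \<times> 'b) list \<Rightarrow> ('a list \<times> 'b) list" where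
  "extend_hd a [] = []"
| "extend_hd a ((x, b) # ps) = (a # x, b) # ps"

lemma factorisations0_altdef:
  "factorisations0 w = {ps. concat (map (\<lambda>(a, b). a @ b) ps) = w \<and>
     (\<forall>(a, b)\<in>set ps. a \<noteq> []) \<and> (\<forall>(a, b)\<in>set (butlast ps). b \<noteq> [])}"
proof (cases "w = []")
  case True
  have "ps = []" if "\<forall>p\<in>set ps. (case p of (a, b) \<Rightarrow> a @ b) = []" "\<forall>(a, b)\<in>set ps. a \<noteq> []"
    for ps :: "('a word \<times> 'a word) list"
    using that by (cases ps) auto
  with True show ?thesis by (auto simp: factorisations0_def)
qed (auto simp: factorisations0_def factorisations_def)

lemma finite_factorisations0: "finite (factorisations0 w)"
  by (simp add: factorisations0_def finite_factorisations)

text \<open>If the first component has more than one letter, deleting \<open>a\<close> leaves a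
  factorisation of \<open>w\<close>. Otherwise its partner is nonempty because \<open>w\<close> is,
  and the remainder is factorised arbitrarily.\<close>

lemma factorisations_Cons:
  assumes "w \<noteq> []"
  shows "factorisations (a # w) = extend_hd a ` factorisations w \<union>
    (\<Union>i\<in>{1..length w}. (#) ([a], take i w) ` factorisations0 (drop i w))"
proof (intro equalityI subsetI)
  fix ps assume ps: "ps \<in> factorisations (a # w)"
  then obtain x b qs where ps_eq: "ps = (x, b) # qs"
    by (cases ps) (auto simp: factorisations_def)
  with ps obtain y where x: "x = a # y"
    by (cases x) (auto simp: factorisations_def)
  have w: "y @ b @ concat (map (\<lambda>(a, b). a @ b) qs) = w"
    using ps ps_eq x by (simp add: factorisations_def)
  have qs: "\<forall>(a, b)\<in>set qs. a \<noteq> []" "\<forall>(a, b)\<in>set (butlast qs). b \<noteq> []"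
    using ps ps_eq by (auto simp: factorisations_def split: if_splits)
  have b: "qs \<noteq> [] \<Longrightarrow> b \<noteq> []"
    using ps ps_eq by (auto simp: factorisations_def)
  show "ps \<in> extend_hd a ` factorisations w \<union>
    (\<Union>i\<in>{1..length w}. (#) ([a], take i w) ` factorisations0 (drop i w))"
  proof (cases "y = []")
    case False
    then have "(y, b) # qs \<in> factorisations w"
      using w qs b by (auto simp: factorisations_def)
    then show ?thesis
      using ps_eq x by (intro UnI1 image_eqI[of _ _ "(y, b) # qs"]) simp_all
  next
    case True
    have "b \<noteq> []" using b w True assms by (cases "qs = []") auto
    moreover have "take (length b) w = b" "drop (length b) w = concat (map (\<lambda>(a, b). a @ b) qs)"
      "length b \<le> length w"
      using w True by auto
    moreover have "qs \<in> factorisations0 (drop (length b) w)"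
      using calculation qs by (simp add: factorisations0_altdef)
    ultimately show ?thesis
      using ps_eq x True
      by (intro UnI2 UN_I[of "length b"]) (auto simp: Suc_le_eq)
  qed
next
  fix ps assume "ps \<in> extend_hd a ` factorisations w \<union>
    (\<Union>i\<in>{1..length w}. (#) ([a], take i w) ` factorisations0 (drop i w))"
  then show "ps \<in> factorisations (a # w)"
  proof
    assume "ps \<in> extend_hd a ` factorisations w"
    then obtain qs where qs: "qs \<in> factorisations w" "ps = extend_hd a qs" by blast
    then show ?thesis
      by (cases "(a, qs)" rule: extend_hd.cases) (auto simp: factorisations_def split: if_splits)
  next
    assume "ps \<in> (\<Union>i\<in>{1..length w}. (#) ([a], take i w) ` factorisations0 (drop i w))"
    then obtain i qs where "i \<in> {1..length w}" "qs \<in> factorisations0 (drop i w)"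
      "ps = ([a], take i w) # qs" by blast
    then show ?thesis
      by (auto simp: factorisations_def factorisations0_altdef split: if_splits)
  qed
qed

lemma factorisations_singleton: "factorisations [a] = {[([a], [])]}"
proof (intro equalityI subsetI)
  fix ps assume ps: "ps \<in> factorisations [a]"
  then obtain x b qs where ps_eq: "ps = (x, b) # qs"
    by (cases ps) (auto simp: factorisations_def)
  with ps show "ps \<in> {[([a], [])]}"
    by (cases x; cases qs) (auto simp: factorisations_def)
qed (auto simp: factorisations_def)

lemma sum_factorisations_Cons:
  assumes "w \<noteq> []"
  shows "sum g (factorisations (a # w)) = (\<Sum>ps\<in>factorisations w. g (extend_hd a ps)) +
    (\<Sum>i=1..length w. \<Sum>ps\<in>factorisations0 (drop i w). g (([a], take i w) # ps))"
proof -
  let ?X = "extend_hd a ` factorisations w"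
  let ?Y = "\<lambda>i. (#) ([a], take i w) ` factorisations0 (drop i w)"
  have disj: "?X \<inter> (\<Union>i\<in>{1..length w}. ?Y i) = {}"
  proof -
    have "extend_hd a ps \<noteq> ([a], u) # qs" if "ps \<in> factorisations w" for ps u qs
      using that by (cases "(a, ps)" rule: extend_hd.cases) (auto simp: factorisations_def)
    then show ?thesis by blast
  qed
  have inj: "inj_on (extend_hd a) (factorisations w)"
  proof (rule inj_onI)
    fix ps qs assume "ps \<in> factorisations w" "qs \<in> factorisations w" "extend_hd a ps = extend_hd a qs"
    then show "ps = qs"
      by (cases "(a, ps)" rule: extend_hd.cases; cases "(a, qs)" rule: extend_hd.cases)
        (auto simp: factorisations_def)
  qed
  have "sum g (factorisations (a # w)) = sum g ?X + sum g (\<Union>i\<in>{1..length w}. ?Y i)"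
    unfolding factorisations_Cons[OF assms]
    using disj by (intro sum.union_disjoint) (auto simp: finite_factorisations finite_factorisations0)
  also have "sum g ?X = (\<Sum>ps\<in>factorisations w. g (extend_hd a ps))"
    using inj by (simp add: sum.reindex)
  also have "sum g (\<Union>i\<in>{1..length w}. ?Y i) = (\<Sum>i=1..length w. sum g (?Y i))"
  proof (intro sum.UNION_disjoint ballI impI)
    fix i j assume "i \<in> {1..length w}" "j \<in> {1..length w}" "i \<noteq> j"
    then have "take i w \<noteq> take j w"
      by (metis atLeastAtMost_iff length_take min.absorb2)
    then show "?Y i \<inter> ?Y j = {}" by auto
  qed (auto simp: finite_factorisations0)
  also have "(\<Sum>i=1..length w. sum g (?Y i)) =
      (\<Sum>i=1..length w. \<Sum>ps\<in>factorisations0 (drop i w). g (([a], take i w) # ps))"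
    by (simp add: sum.reindex)
  finally show ?thesis .
qed

lemma flex_right_altdef: "flex_right a b = butlast a @ [absorb (last a) b]"
  by (simp add: flex_right_def absorb_def)

text \<open>The recursion for factorisations matches that of \<open>contr\<close>: extending the
  first component makes \<open>a\<close> a block by itself, and a first pair \<open>([a], b)\<close>
  is the block \<open>a # b\<close>.\<close>

lemma sum_factorisations:
  fixes G :: "'g::ab_group_add word \<Rightarrow> 'k::comm_ring_1"
  shows "(\<Sum>ps\<in>factorisations0 w. (\<Prod>(a, b)\<leftarrow>ps. weight c (snd (last a)) b) *
      G (concat (map (\<lambda>(a, b). flex_right a b) ps))) = contr c G w"
proof (induction "length w" arbitrary: w G rule: less_induct)
  case less
  let ?W = "\<lambda>ps. \<Prod>(a, b)\<leftarrow>ps. weight c (snd (last a)) b"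
  let ?C = "\<lambda>ps. concat (map (\<lambda>(a, b). flex_right a b) ps)"
  let ?S = "\<lambda>G w. \<Sum>ps\<in>factorisations0 w. ?W ps * G (?C ps)"
  show ?case
  proof (cases w)
    case Nil
    then show ?thesis by (simp add: factorisations0_def)
  next
    case (Cons a v)
    let ?G = "\<lambda>i t. G (absorb a (take i v) # t)"
    have "?S G w = (\<Sum>i\<le>length v. weight c (snd a) (take i v) * ?S (?G i) (drop i v))"
    proof (cases "v = []")
      case True
      then show ?thesis
        by (simp add: Cons factorisations0_def factorisations_singleton flex_right_altdef)
    next
      case False
      have flex_right_single: "flex_right [a] u = [absorb a u]" for u
        by (simp add: flex_right_altdef)
      \<comment> \<open>The weight and the right flexion change or read only the last letter of a
        component, which \<open>extend_hd\<close> leaves alone.\<close>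
      have extend: "?W (extend_hd a ps) * G (?C (extend_hd a ps)) = ?W ps * G (a # ?C ps)"
        if "ps \<in> factorisations v" for ps
        using that by (cases "(a, ps)" rule: extend_hd.cases)
          (auto simp: factorisations_def flex_right_altdef)
      have "?S G w = (\<Sum>ps\<in>factorisations v. ?W ps * G (a # ?C ps)) +
          (\<Sum>i=1..length v. \<Sum>ps\<in>factorisations0 (drop i v).
            weight c (snd a) (take i v) * ?W ps * ?G i (?C ps))"
        using False by (simp add: Cons factorisations0_def[of "a # v"] sum_factorisations_Cons
            extend flex_right_single)
      \<comment> \<open>The extended factorisations supply the summand \<open>i = 0\<close>, since
        \<open>absorb a [] = a\<close>.\<close>
      also have "(\<Sum>ps\<in>factorisations v. ?W ps * G (a # ?C ps)) =
          weight c (snd a) (take 0 v) * ?S (?G 0) (drop 0 v)"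
        using False by (simp add: factorisations0_def)
      also have "(\<Sum>i=1..length v. \<Sum>ps\<in>factorisations0 (drop i v).
            weight c (snd a) (take i v) * ?W ps * ?G i (?C ps)) =
          (\<Sum>i=1..length v. weight c (snd a) (take i v) * ?S (?G i) (drop i v))"
        by (simp add: sum_distrib_left mult.assoc)
      finally show ?thesis
        by (simp add: sum.atLeast_Suc_atMost[of 0] atMost_atLeast0)
    qed
    also have "\<dots> = (\<Sum>i\<le>length v. weight c (snd a) (take i v) * contr c (?G i) (drop i v))"
    proof -
      have "?S (?G i) (drop i v) = contr c (?G i) (drop i v)" for i
        by (rule less.hyps) (simp add: Cons)
      then show ?thesis by simp
    qed
    finally show ?thesis by (simp add: Cons contr.simps(2))
  qed
qed

section \<open>Moulds as functionals on words\<close>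

definition var_word :: "('g \<times> nat) list \<Rightarrow> 'g word" where
  "var_word = map (apsnd (\<lambda>i. Poly_Mapping.single i 1))"

definition index_word :: "'g list \<Rightarrow> ('g \<times> nat) list" where
  "index_word \<sigma> = zip \<sigma> [0..<length \<sigma>]"

definition val :: "'g mould \<Rightarrow> ('g \<times> nat) list \<Rightarrow> ratfun" where
  "val M w = mould_val M (var_word w)"

lemma length_index_word [simp]: "length (index_word \<sigma>) = length \<sigma>"
  and map_fst_index_word [simp]: "map fst (index_word \<sigma>) = \<sigma>"
  and map_snd_index_word [simp]: "map snd (index_word \<sigma>) = [0..<length \<sigma>]"
  by (simp_all add: index_word_def)

lemma index_word_Nil_iff [simp]: "index_word \<sigma> = [] \<longleftrightarrow> \<sigma> = []"
  by (metis length_0_conv length_index_word)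

lemma index_word_dwords: "index_word \<sigma> \<in> dwords {..<length \<sigma>}"
  unfolding dwords_def by (auto simp: index_word_def set_zip)

lemma vword_eq: "vword \<sigma> = var_word (index_word \<sigma>)"
  by (rule nth_equalityI) (simp_all add: vword_def var_word_def index_word_def)

lemma linform_val_single [simp]: "linform_val (Poly_Mapping.single i 1) = rvar i"
  by (simp add: linform_val_def)

lemma linform_val_diff:
  "linform_val (Poly_Mapping.single i 1 - Poly_Mapping.single j 1) = rvar i - rvar j"
proof (cases "i = j")
  case False
  then have "Poly_Mapping.keys (Poly_Mapping.single i 1 - Poly_Mapping.single j (1::int)) = {i, j}"
    by (auto simp: in_keys_iff lookup_minus lookup_single when_def split: if_splits)
  then show ?thesis
    using False by (simp add: linform_val_def lookup_minus lookup_single)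
qed (simp add: linform_val_def)

lemma obtain_inj_nth:
  fixes ks :: "nat list"
  assumes "distinct ks"
  obtains k where "inj k" "\<And>i. i < length ks \<Longrightarrow> k i = ks ! i"
proof
  \<comment> \<open>Beyond the list, the shift by \<open>Suc (sum_list ks)\<close> exceeds every
    entry of \<open>ks\<close>.\<close>
  let ?k = "\<lambda>i. if i < length ks then ks ! i else i + Suc (sum_list ks)"
  have le: "ks ! i \<le> sum_list ks" if "i < length ks" for i
    using that by (simp add: elem_le_sum_list)
  show "inj ?k"
  proof (rule injI)
    fix i j assume "?k i = ?k j"
    then show "i = j"
      using le[of i] le[of j] assms by (auto simp: nth_eq_iff_index_eq split: if_splits)
  qed
qed simp

lemma obtain_index_word:
  fixes w :: "('g \<times> nat) list"
  assumes "distinct (map snd w)"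
  obtains k where "inj k" "w = map (apsnd k) (index_word (map fst w))"
proof -
  obtain k where k: "inj k" "\<And>i. i < length w \<Longrightarrow> k i = snd (w ! i)"
    using obtain_inj_nth[OF assms] by auto
  have "w = map (apsnd k) (index_word (map fst w))"
    by (rule nth_equalityI) (auto simp: index_word_def k(2) apsnd_def map_prod_def prod_eq_iff)
  with k(1) show thesis by (rule that)
qed

lemma distinct_map_apsnd:
  "inj k \<Longrightarrow> distinct (map snd (map (apsnd k) w)) \<longleftrightarrow> distinct (map snd w)"
proof -
  have "map snd (map (apsnd k) w) = map k (map snd w)" by simp
  then show "inj k \<Longrightarrow> ?thesis"
    by (metis distinct_map inj_on_subset subset_UNIV)
qed

lemma BIMU_I: "(\<And>\<sigma>. M \<sigma> \<in> ratfuns (length \<sigma>)) \<Longrightarrow> M \<in> BIMU"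
  and BIMU_D: "M \<in> BIMU \<Longrightarrow> M \<sigma> \<in> ratfuns (length \<sigma>)"
  by (simp_all add: BIMU_def)

lemma val_eq_rename:
  assumes "M \<in> BIMU" "inj k" "\<And>i. i < length w \<Longrightarrow> k i = snd (w ! i)"
  shows "val M w = rename k (M (map fst w))"
proof -
  have fst: "map fst (var_word w) = map fst w"
    by (simp add: var_word_def)
  have "M (map fst w) \<in> ratfuns (length w)"
    using BIMU_D[OF assms(1), of "map fst w"] by simp
  then show ?thesis
    unfolding val_def mould_val_def fst using assms(2,3)
    by (intro ratfun_subst_eq_rename) (auto simp: var_word_def)
qed

lemma val_index_word [simp]: "M \<in> BIMU \<Longrightarrow> val M (index_word \<sigma>) = M \<sigma>"
  by (subst val_eq_rename[where k = id]) (simp_all add: rename_id index_word_def)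

lemma val_Nil [simp]: "M \<in> BIMU \<Longrightarrow> val M [] = M []"
  using val_index_word[of M "[]"] by (simp add: index_word_def)

lemma rename_val:
  assumes "M \<in> BIMU" "inj k" "distinct (map snd w)"
  shows "rename k (val M w) = val M (map (apsnd k) w)"
proof -
  obtain l where l: "inj l" "\<And>i. i < length w \<Longrightarrow> l i = snd (w ! i)"
    using obtain_inj_nth[OF assms(3)] by auto
  have "val M (map (apsnd k) w) = rename (k \<circ> l) (M (map fst w))"
    using assms(1,2) l by (subst val_eq_rename[where k = "k \<circ> l"]) (auto intro!: inj_compose)
  then show ?thesis
    using assms l by (simp add: val_eq_rename[OF assms(1) l] rename_rename)
qed

lemma val_ratfuns:
  assumes "M \<in> BIMU" "w \<in> dwords {..<m}"
  shows "val M w \<in> ratfuns m"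
proof -
  obtain k where k: "inj k" "\<And>i. i < length w \<Longrightarrow> k i = snd (w ! i)"
    using assms(2) obtain_inj_nth[of "map snd w"] by (auto simp: dwords_def)
  have "k ` {..<length w} \<subseteq> {..<m}"
    using k(2) assms(2) by (auto simp: dwords_def set_conv_nth)
  moreover have "M (map fst w) \<in> ratfuns (length w)"
    using BIMU_D[OF assms(1), of "map fst w"] by simp
  ultimately show ?thesis
    using k ratfuns_rename[of k "length w" m] by (simp add: val_eq_rename[OF assms(1) k])
qed

text \<open>Identities between functionals need only be checked on the words \<open>v\<^sub>1 \<dots> v\<^sub>m\<close>: renaming of
  variables carries them over to all words with distinct variables.\<close>

lemma val_eqI:
  assumes M: "M \<in> BIMU" and eq: "\<And>\<sigma>. M \<sigma> = \<Phi> (index_word \<sigma>)"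
    and equiv: "\<And>k w. inj k \<Longrightarrow> distinct (map snd w) \<Longrightarrow> rename k (\<Phi> w) = \<Phi> (map (apsnd k) w)"
    and w: "distinct (map snd w)"
  shows "val M w = \<Phi> w"
proof -
  obtain k where k: "inj k" "w = map (apsnd k) (index_word (map fst w))"
    by (rule obtain_index_word[OF w])
  have d: "distinct (map snd (index_word (map fst w)))" by simp
  have "val M w = rename k (val M (index_word (map fst w)))"
    by (subst k(2)) (simp only: rename_val[OF M k(1) d])
  also have "\<dots> = rename k (\<Phi> (index_word (map fst w)))"
    by (simp add: M eq)
  also have "\<dots> = \<Phi> w"
    by (subst (2) k(2)) (simp only: equiv[OF k(1) d])
  finally show ?thesis .
qed

section \<open>Product and exponential of moulds as convolutions\<close>

lemma take_vword: "take i (vword \<sigma>) = var_word (take i (index_word \<sigma>))"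
  and drop_vword: "drop i (vword \<sigma>) = var_word (drop i (index_word \<sigma>))"
  by (simp_all add: vword_eq var_word_def take_map drop_map)

lemma mould_mult_eq: "mould_mult A B \<sigma> = conv (val A) (val B) (index_word \<sigma>)"
  by (simp add: mould_mult_def conv_def deconc_def val_def take_vword drop_vword)

lemma dwords_takeI: "w \<in> dwords S \<Longrightarrow> take i w \<in> dwords S"
  and dwords_dropI: "w \<in> dwords S \<Longrightarrow> drop i w \<in> dwords S"
  by (auto simp: dwords_def take_map[symmetric] drop_map[symmetric] dest: in_set_takeD in_set_dropD)

lemma mould_mult_BIMU:
  assumes "A \<in> BIMU" "B \<in> BIMU"
  shows "mould_mult A B \<in> BIMU"
  using assms index_word_dwords
  by (intro BIMU_I) (auto simp: mould_mult_eq conv_def deconc_def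
      intro!: ratfuns_sum ratfuns_mult val_ratfuns dwords_takeI dwords_dropI)

lemma val_mould_mult:
  assumes "A \<in> BIMU" "B \<in> BIMU" "distinct (map snd w)"
  shows "val (mould_mult A B) w = conv (val A) (val B) w"
proof (rule val_eqI[where \<Phi> = "conv (val A) (val B)",
      OF mould_mult_BIMU[OF assms(1,2)] mould_mult_eq _ assms(3)])
  fix k :: "nat \<Rightarrow> nat" and w :: "('a \<times> nat) list" assume "inj k" "distinct (map snd w)"
  then show "rename k (conv (val A) (val B) w) = conv (val A) (val B) (map (apsnd k) w)"
    by (simp add: conv_def deconc_def rename_sum rename_mult rename_val assms take_map[symmetric]
        drop_map[symmetric])
qed

lemma mould_one_BIMU: "mould_one \<in> BIMU"
  by (simp add: BIMU_def mould_one_def)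

lemma val_mould_one:
  assumes "distinct (map snd w)"
  shows "val mould_one w = counit w"
  by (rule val_eqI[OF mould_one_BIMU _ _ assms]) (simp_all add: mould_one_def counit_def)

lemma mould_power_BIMU: "A \<in> BIMU \<Longrightarrow> mould_power A n \<in> BIMU"
  by (induction n) (simp_all add: mould_one_BIMU mould_mult_BIMU)

lemma val_mould_power:
  assumes "A \<in> BIMU" "distinct (map snd w)"
  shows "val (mould_power A n) w = conv_power (val A) n w"
  using assms(2)
proof (induction n arbitrary: w)
  case (Suc n)
  then have "conv (val A) (val (mould_power A n)) w = conv (val A) (conv_power (val A) n) w"
    unfolding conv_def by (intro deconc_cong) auto
  with Suc.prems show ?case
    by (simp add: val_mould_mult mould_power_BIMU assms(1))
qed (simp add: val_mould_one)

abbreviation inverse_fact :: "nat \<Rightarrow> ratfun" where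
  "inverse_fact k \<equiv> rconst (1 / fact k)"

lemma ARI_D: "A \<in> ARI \<Longrightarrow> A \<in> BIMU" "A \<in> ARI \<Longrightarrow> A [] = 0" "A \<in> ARI \<Longrightarrow> val A [] = 0"
  by (simp_all add: ARI_def)

lemma mould_power_eq:
  assumes "A \<in> BIMU" shows "mould_power A k \<sigma> = conv_power (val A) k (index_word \<sigma>)"
  using val_mould_power[OF assms, of "index_word \<sigma>" k] mould_power_BIMU[OF assms, of k] by simp

lemma mould_exp_eq:
  assumes "A \<in> ARI"
  shows "mould_exp A \<sigma> = conv_exp inverse_fact (val A) (index_word \<sigma>)"
proof -
  have "{k. inverse_fact k * mould_power A k \<sigma> \<noteq> 0} \<subseteq> {..length \<sigma>}"
  proof (rule subsetI, rule ccontr)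
    fix k assume "k \<in> {k. inverse_fact k * mould_power A k \<sigma> \<noteq> 0}" "k \<notin> {..length \<sigma>}"
    then show False
      using conv_power_eq_0[of "val A" "index_word \<sigma>" k] assms
      by (simp add: mould_power_eq ARI_D)
  qed
  then show ?thesis
    unfolding mould_exp_def using assms
    by (subst Sum_any.expand_superset[of "{..length \<sigma>}"]) (simp_all add: conv_exp_def mould_power_eq ARI_D)
qed

lemma mould_exp_GARI:
  assumes "A \<in> ARI"
  shows "mould_exp A \<in> GARI"
proof -
  have "mould_exp A \<sigma> \<in> ratfuns (length \<sigma>)" for \<sigma>
  proof -
    have "mould_power A k \<sigma> \<in> ratfuns (length \<sigma>)" for k
      using mould_power_BIMU[OF ARI_D(1)[OF assms], of k] by (simp add: BIMU_def)
    then show ?thesis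
      using assms by (auto simp: mould_exp_eq conv_exp_def mould_power_eq[symmetric] ARI_D
          intro!: ratfuns_sum ratfuns_mult ratfuns_rconst)
  qed
  moreover have "mould_exp A [] = 1"
    using assms by (simp add: mould_exp_eq conv_exp_def index_word_def)
  ultimately show ?thesis
    by (simp add: GARI_def BIMU_def)
qed

lemma val_mould_exp:
  assumes "A \<in> ARI" "distinct (map snd w)"
  shows "val (mould_exp A) w = conv_exp inverse_fact (val A) w"
proof (rule val_eqI[where \<Phi> = "conv_exp inverse_fact (val A)",
      OF _ mould_exp_eq[OF assms(1)] _ assms(2)])
  show "mould_exp A \<in> BIMU" using mould_exp_GARI[OF assms(1)] by (simp add: GARI_def)
next
  fix k :: "nat \<Rightarrow> nat" and w :: "('a \<times> nat) list" assume kw: "inj k" "distinct (map snd w)"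
  then have "rename k (conv_power (val A) n w) = conv_power (val A) n (map (apsnd k) w)" for n
    using rename_val[OF mould_power_BIMU kw, of A n] assms(1)
    by (simp add: val_mould_power ARI_D distinct_map_apsnd del: map_map)
  then show "rename k (conv_exp inverse_fact (val A) w) = conv_exp inverse_fact (val A) (map (apsnd k) w)"
    using kw by (simp add: conv_exp_def rename_sum rename_mult rename_rconst)
qed

section \<open>The map \<open>ganit pic\<close> as a contraction\<close>

lemma mould_val_pic:
  assumes "\<And>l. l \<in> set \<beta> \<Longrightarrow> linform_val (snd l) \<noteq> 0"
  shows "mould_val pic \<beta> = (\<Prod>l\<leftarrow>\<beta>. 1 / linform_val (snd l))"
proof -
  let ?n = "length \<beta>"
  let ?f = "\<lambda>i. if i < ?n then linform_val (snd (\<beta> ! i)) else 0"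
  \<comment> \<open>\<open>ratfun_subst\<close> needs one representing fraction whose denominator
    survives; this denominator becomes a product of nonzero forms.\<close>
  let ?p = "\<Prod>i<?n. Poly_Mapping.single (Poly_Mapping.single i 1) 1 :: rpoly"
  have subst [simp]: "rpoly_subst ?f ?p = (\<Prod>i<?n. linform_val (snd (\<beta> ! i)))"
    by (simp add: rpoly_subst_prod)
  have "pic (map fst \<beta>) = Fract 1 ?p"
    by (simp add: pic_def rvar_def Fract_prod One_fract_def del: One_nat_def)
  then have "mould_val pic \<beta> = 1 / (\<Prod>i<?n. linform_val (snd (\<beta> ! i)))"
    unfolding mould_val_def using assms
    by (simp only:) (subst ratfun_subst_Fract, simp_all add: subst del: One_nat_def)
  also have "\<dots> = (\<Prod>i<?n. 1 / linform_val (snd (\<beta> ! i)))"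
    by (simp add: prod_dividef)
  also have "\<dots> = (\<Prod>l\<leftarrow>\<beta>. 1 / linform_val (snd l))"
    by (simp add: prod.list_conv_set_nth atLeast0LessThan)
  finally show ?thesis .
qed

lemma mem_factorisationsD:
  assumes "ps \<in> factorisations w" "(a, b) \<in> set ps"
  obtains x y where "w = x @ a @ b @ y" "a \<noteq> []"
proof -
  obtain qs rs where "ps = qs @ (a, b) # rs" using assms(2) by (meson split_list)
  then show thesis
    using assms(1) that by (auto simp: factorisations_def)
qed

lemma ganit_pic_eq: "ganit pic A \<sigma> = contr (recip rvar) (val A) (index_word \<sigma>)"
  if A: "A \<in> BIMU"
proof (cases "\<sigma> = []")
  case True
  then show ?thesis by (simp add: ganit_def index_word_def A)
next
  case False
  let ?c = "\<lambda>y z. 1 / linform_val (z - y)"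
  let ?w = "index_word \<sigma>"
  have vars: "snd l \<in> range (\<lambda>i. Poly_Mapping.single i 1)" if "l \<in> set (vword \<sigma>)" for l
    using that by (auto simp: vword_def)
  have distinct: "distinct (map snd (vword \<sigma>))"
  proof -
    have "inj (\<lambda>i::nat. Poly_Mapping.single i (1::int))"
      by (rule injI) (auto dest!: arg_cong[of _ _ Poly_Mapping.keys])
    then show ?thesis
      by (auto simp: vword_def comp_def distinct_map intro: inj_on_subset)
  qed
  have pic: "mould_val pic (flex_left a b) = weight ?c (snd (last a)) b"
    if ps: "ps \<in> factorisations (vword \<sigma>)" "(a, b) \<in> set ps" for ps a b
  proof -
    obtain x y where xy: "vword \<sigma> = x @ a @ b @ y" "a \<noteq> []"
      using mem_factorisationsD[OF ps] by blast
    have nz: "linform_val (snd l - snd (last a)) \<noteq> 0" if l: "l \<in> set b" for l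
    proof -
      have la: "last a \<in> set a" using xy by simp
      obtain i j where ij: "snd l = Poly_Mapping.single i 1" "snd (last a) = Poly_Mapping.single j 1"
        using vars[of l] vars[of "last a"] la l xy by auto
      have "snd l \<noteq> snd (last a)"
        using distinct la l unfolding xy by (auto simp: image_iff)
      then have "i \<noteq> j" using ij by auto
      then show ?thesis
        using ij inj_rvar by (simp add: linform_val_diff inj_eq)
    qed
    have "linform_val (z - snd (last a)) \<noteq> 0" if "(g, z) \<in> set b" for g z
      using nz[OF that] by simp
    then show ?thesis
      by (subst mould_val_pic) (auto simp: flex_left_def weight_def split_beta comp_def)
  qed
  have "ganit pic A \<sigma> = (\<Sum>ps\<in>factorisations (vword \<sigma>).
      (\<Prod>(a, b)\<leftarrow>ps. weight ?c (snd (last a)) b) *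
      mould_val A (concat (map (\<lambda>(a, b). flex_right a b) ps)))"
    using False unfolding ganit_def
    by (auto intro!: sum.cong arg_cong2[of _ _ _ _ "(*)"] arg_cong[of _ _ prod_list] simp: pic)
  also have "\<dots> = contr ?c (mould_val A) (vword \<sigma>)"
    using False sum_factorisations[of ?c "mould_val A" "vword \<sigma>"]
    by (simp add: factorisations0_def vword_def)
  \<comment> \<open>Return from linear forms to indices: \<open>h\<close> is the identity and
    \<open>r\<close> sends an index to its variable.\<close>
  also have "\<dots> = contr (recip rvar) (val A) ?w"
    unfolding vword_eq var_word_def
    by (rule contr_equivariant[of "\<lambda>x. x", symmetric])
      (simp_all add: recip_def linform_val_diff val_def var_word_def)
  finally show ?thesis .
qed

lemma contr_ratfuns:
  assumes "w \<in> dwords {..<m}" "\<And>u. u \<in> dwords {..<m} \<Longrightarrow> F u \<in> ratfuns m"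
  shows "contr (recip rvar) F w \<in> ratfuns m"
proof -
  \<comment> \<open>Stated for sets \<open>S\<close> of variables, since after the first letter
    \<open>a\<close> the hypothesis on \<open>F\<close> is available only for tails avoiding its
    variable.\<close>
  have "contr (recip rvar) F w \<in> ratfuns m"
    if "S \<subseteq> {..<m}" "w \<in> dwords S" "\<And>u. u \<in> dwords S \<Longrightarrow> F u \<in> ratfuns m" for S
    using that
  proof (induction "length w" arbitrary: w F S rule: less_induct)
    case less
    show ?case
    proof (cases w)
      case Nil
      then show ?thesis using less.prems(3)[of "[]"] by (simp add: dwords_def)
    next
      case (Cons a v)
      have a: "snd a \<in> {..<m}" and v: "v \<in> dwords (S - {snd a})"
        using less.prems(1,2) Cons by (auto simp: dwords_Cons_iff)
      have "contr (recip rvar) (\<lambda>t. F (absorb a (take i v) # t)) (drop i v) \<in> ratfuns m" for i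
      proof (rule less.hyps)
        show "drop i v \<in> dwords (S - {snd a})" by (rule dwords_dropI[OF v])
        show "F (absorb a (take i v) # t) \<in> ratfuns m" if "t \<in> dwords (S - {snd a})" for t
          using that less.prems(2) Cons by (intro less.prems(3)) (simp add: dwords_Cons_iff)
      qed (use Cons less.prems(1) in auto)
      moreover have "weight (recip rvar) (snd a) u \<in> ratfuns m" if "snd ` set u \<subseteq> {..<m}"
        for u :: "('a \<times> nat) list"
        using that a
        by (induction u) (auto simp: recip_def intro!: ratfuns_mult ratfuns_divide ratfuns_diff ratfuns_rvar)
      moreover have "snd ` set (take i v) \<subseteq> {..<m}" for i
        using dwords_takeI[OF v, of i] less.prems(1) by (auto simp: dwords_def)
      ultimately show ?thesis
        by (auto simp: Cons contr.simps(2) intro!: ratfuns_sum ratfuns_mult)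
    qed
  qed
  from this[of "{..<m}"] assms show ?thesis by blast
qed

lemma ganit_pic_BIMU: "A \<in> BIMU \<Longrightarrow> ganit pic A \<in> BIMU"
  using index_word_dwords
  by (intro BIMU_I) (auto simp: ganit_pic_eq intro!: contr_ratfuns val_ratfuns)

lemma ganit_pic_Nil [simp]: "ganit pic A [] = A []"
  by (simp add: ganit_def)

lemma val_ganit_pic:
  assumes "A \<in> BIMU" "distinct (map snd w)"
  shows "val (ganit pic A) w = contr (recip rvar) (val A) w"
proof (rule val_eqI[where \<Phi> = "contr (recip rvar) (val A)",
      OF ganit_pic_BIMU[OF assms(1)] ganit_pic_eq[OF assms(1)] _ assms(2)])
  fix k :: "nat \<Rightarrow> nat" and w :: "('a \<times> nat) list" assume "inj k" "distinct (map snd w)"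
  then show "rename k (contr (recip rvar) (val A) w) = contr (recip rvar) (val A) (map (apsnd k) w)"
    using assms(1)
    by (intro contr_equivariant)
      (auto simp: rename_add rename_mult rename_val dwords_def recip_def rename_divide rename_diff rename_rvar)
qed

section \<open>Symmetry types\<close>

text \<open>The functional is arbitrary because the recursion through \<open>prefix_letter\<close>
  leaves the functionals of the form \<open>mould_val M\<close>.\<close>

definition pairing :: "('g word \<Rightarrow> ratfun) \<Rightarrow> 'g word_comb \<Rightarrow> ratfun" where
  "pairing F P = (\<Sum>\<alpha>\<in>Poly_Mapping.keys P. Poly_Mapping.lookup P \<alpha> * F \<alpha>)"

lemma pairing_superset:
  assumes "finite S" "Poly_Mapping.keys P \<subseteq> S"
  shows "pairing F P = (\<Sum>\<alpha>\<in>S. Poly_Mapping.lookup P \<alpha> * F \<alpha>)"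
  unfolding pairing_def using assms
  by (intro sum.mono_neutral_left) (auto simp: in_keys_iff)

lemma pairing_0 [simp]: "pairing F 0 = 0"
  by (simp add: pairing_def)

lemma pairing_single [simp]: "pairing F (Poly_Mapping.single w c) = c * F w"
  by (cases "c = 0") (simp_all add: pairing_def)

lemma pairing_add [simp]: "pairing F (P + Q) = pairing F P + pairing F Q"
proof -
  let ?S = "Poly_Mapping.keys P \<union> Poly_Mapping.keys Q"
  have "Poly_Mapping.keys (P + Q) \<subseteq> ?S" by (rule keys_add)
  then show ?thesis
    by (simp add: pairing_superset[of ?S] lookup_add distrib_right sum.distrib)
qed

lemma pairing_diff [simp]: "pairing F (P - Q) = pairing F P - pairing F Q"
  using pairing_add[of F "P - Q" Q] by simp

lemma pairing_sum: "pairing F (sum g I) = (\<Sum>i\<in>I. pairing F (g i))"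
  by (induction I rule: infinite_finite_induct) simp_all

lemma pairing_prefix_letter [simp]: "pairing F (prefix_letter a P) = pairing (\<lambda>w. F (a # w)) P"
  by (simp add: prefix_letter_def pairing_sum) (simp add: pairing_def)

lemma pairing_scale_comb [simp]: "pairing F (scale_comb c P) = c * pairing F P"
proof -
  have "Poly_Mapping.keys (scale_comb c P) \<subseteq> Poly_Mapping.keys P"
    by (auto simp: scale_comb_def in_keys_iff Poly_Mapping.map.rep_eq when_def)
  then show ?thesis
    by (simp add: pairing_superset[of "Poly_Mapping.keys P"] scale_comb_def Poly_Mapping.map.rep_eq when_def
        sum_distrib_left mult.assoc cong: if_cong)
      (auto intro!: sum.cong)
qed

lemma pairing_shuffle:
  "pairing F (shuffle (var_word u) (var_word v)) = qsh (\<lambda>i j. 0) (\<lambda>w. F (var_word w)) u v"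
proof (induction "length u + length v" arbitrary: u v F rule: less_induct)
  case less
  show ?case
  proof (cases u; cases v)
    fix a u' b v' assume uv: "u = a # u'" "v = b # v'"
    have 1: "pairing G (shuffle (var_word u') (var_word v)) = qsh (\<lambda>i j. 0) (\<lambda>w. G (var_word w)) u' v"
      "pairing G (shuffle (var_word u) (var_word v')) = qsh (\<lambda>i j. 0) (\<lambda>w. G (var_word w)) u v'" for G
      using uv by (auto intro!: less.hyps)
    show ?thesis
      using 1[of "\<lambda>w. F (apsnd (\<lambda>i. Poly_Mapping.single i 1) a # w)"]
        1[of "\<lambda>w. F (apsnd (\<lambda>i. Poly_Mapping.single i 1) b # w)"] uv
      by (simp add: var_word_def)
  qed (simp_all add: var_word_def)
qed

abbreviation star :: "nat \<Rightarrow> nat \<Rightarrow> ratfun" where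
  "star \<equiv> \<lambda>i j. recip rvar j i"

text \<open>Joint distinctness passes to all smaller pairs, so the recursion never meets equal
  variables, where the product is set to 0.\<close>

lemma pairing_shuffle_star:
  assumes "distinct (map snd (u @ v))"
  shows "pairing F (shuffle_star (var_word u) (var_word v)) = qsh star (\<lambda>w. F (var_word w)) u v"
  using assms
proof (induction "length u + length v" arbitrary: u v F rule: less_induct)
  case less
  show ?case
  proof (cases u; cases v)
    fix a u' b v' assume uv: "u = a # u'" "v = b # v'"
    have 1: "pairing G (shuffle_star (var_word u') (var_word v)) = qsh star (\<lambda>w. G (var_word w)) u' v"
      "pairing G (shuffle_star (var_word u) (var_word v')) = qsh star (\<lambda>w. G (var_word w)) u v'"
      "pairing G (shuffle_star (var_word u') (var_word v')) = qsh star (\<lambda>w. G (var_word w)) u' v'" for G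
      using uv less.prems by (auto intro!: less.hyps)
    obtain g i h j where ab: "a = (g, i)" "b = (h, j)" by (cases a, cases b)
    have "i \<noteq> j" using less.prems uv ab by auto
    then have "Poly_Mapping.single i (1::int) \<noteq> Poly_Mapping.single j 1"
      by (auto dest!: arg_cong[of _ _ Poly_Mapping.keys])
    then show ?thesis
      using 1(1)[of "\<lambda>w. F ((g, Poly_Mapping.single i 1) # w)"]
        1(2)[of "\<lambda>w. F ((h, Poly_Mapping.single j 1) # w)"]
        1(3)[of "\<lambda>w. F ((g + h, Poly_Mapping.single i 1) # w)"]
        1(3)[of "\<lambda>w. F ((g + h, Poly_Mapping.single j 1) # w)"]
      by (simp add: uv ab var_word_def linform_val_diff recip_def)
  qed (simp_all add: var_word_def)
qed

section \<open>Symmetric moulds as characters and infinitesimal characters\<close>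

lemma mould_pairing_eq: "mould_pairing M P = pairing (mould_val M) P"
  by (simp add: mould_pairing_def pairing_def)

lemma distinct_split_index_word: "distinct (map snd (take p (index_word \<sigma>) @ drop p (index_word \<sigma>)))"
  unfolding append_take_drop_id by simp

lemma mould_pairing_shuffle:
  "mould_pairing M (shuffle (take p (vword \<sigma>)) (drop p (vword \<sigma>))) =
     qsh (\<lambda>i j. 0) (val M) (take p (index_word \<sigma>)) (drop p (index_word \<sigma>))"
  by (simp add: mould_pairing_eq take_vword drop_vword pairing_shuffle val_def[abs_def])

lemma mould_pairing_shuffle_star:
  "mould_pairing M (shuffle_star (take p (vword \<sigma>)) (drop p (vword \<sigma>))) =
     qsh star (val M) (take p (index_word \<sigma>)) (drop p (index_word \<sigma>))"
  by (simp only: mould_pairing_eq take_vword drop_vword val_def[abs_def]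
      pairing_shuffle_star[OF distinct_split_index_word])

text \<open>The symmetry conditions speak only of splits of v_1 ... v_m into two nonempty parts.
  Renaming extends them to all jointly distinct pairs of nonempty words, and the assumptions
  \<open>Nil\<close> cover the pairs with an empty word.\<close>

lemma qsh_transfer:
  fixes M :: "'g::ab_group_add mould"
  assumes M: "M \<in> BIMU"
    and e: "\<And>k i j. inj k \<Longrightarrow> rename k (e i j) = e (k i) (k j)"
    and R: "\<And>k u v. inj k \<Longrightarrow> distinct (map snd (u @ v)) \<Longrightarrow>
      rename k (R u v) = R (map (apsnd k) u) (map (apsnd k) v)"
    and Nil: "\<And>v. R [] v = val M v" "\<And>u. R u [] = val M u"
    and eq: "\<forall>p q \<sigma>. p \<ge> 1 \<longrightarrow> q \<ge> 1 \<longrightarrow> length \<sigma> = p + q \<longrightarrow>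
      qsh e (val M) (take p (index_word \<sigma>)) (drop p (index_word \<sigma>)) =
      R (take p (index_word \<sigma>)) (drop p (index_word \<sigma>))"
    and uv: "distinct (map snd (u @ v))"
  shows "qsh e (val M) u v = R u v"
proof (cases "u = [] \<or> v = []")
  case True
  then show ?thesis using Nil by auto
next
  case False
  define \<sigma> where "\<sigma> = map fst (u @ v)"
  obtain k where k: "inj k" "u @ v = map (apsnd k) (index_word \<sigma>)"
    unfolding \<sigma>_def by (rule obtain_index_word[OF uv])
  let ?u = "take (length u) (index_word \<sigma>)" and ?v = "drop (length u) (index_word \<sigma>)"
  have u: "u = map (apsnd k) ?u"
    using arg_cong[OF k(2), of "take (length u)"] by (simp add: take_map)
  have v: "v = map (apsnd k) ?v"
    using arg_cong[OF k(2), of "drop (length u)"] by (simp add: drop_map)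
  have d: "distinct (map snd (?u @ ?v))" by (rule distinct_split_index_word)
  have "qsh e (val M) (map (apsnd k) ?u) (map (apsnd k) ?v) = rename k (qsh e (val M) ?u ?v)"
    using k(1) d
    by (intro qsh_equivariant[symmetric] e rename_add rename_mult rename_val M) (auto simp: dwords_def)
  also have "qsh e (val M) ?u ?v = R ?u ?v"
    using False eq[rule_format, of "length u" "length v" \<sigma>] by (simp add: \<sigma>_def Suc_le_eq)
  also have "rename k (R ?u ?v) = R (map (apsnd k) ?u) (map (apsnd k) ?v)"
    by (rule R[OF k(1) d])
  finally show ?thesis
    unfolding u[symmetric] v[symmetric] .
qed

lemma qcharacter_iff:
  fixes M :: "'g::ab_group_add mould"
  assumes M: "M \<in> GARI" and e: "\<And>k i j. inj k \<Longrightarrow> rename k (e i j) = e (k i) (k j)"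
  shows "qcharacter e (val M) \<longleftrightarrow> (\<forall>p q \<sigma>. p \<ge> 1 \<longrightarrow> q \<ge> 1 \<longrightarrow> length \<sigma> = p + q \<longrightarrow>
    qsh e (val M) (take p (index_word \<sigma>)) (drop p (index_word \<sigma>)) =
    mould_val M (take p (vword \<sigma>)) * mould_val M (drop p (vword \<sigma>)))" (is "_ \<longleftrightarrow> ?R")
proof
  show ?R if "qcharacter e (val M)"
    using that distinct_split_index_word unfolding qcharacter_def take_vword drop_vword val_def[symmetric]
    by blast
  have B: "M \<in> BIMU" "M [] = 1" using M by (auto simp: GARI_def)
  show "qcharacter e (val M)" if ?R
    unfolding qcharacter_def
  proof (intro allI impI)
    fix u v :: "('g \<times> nat) list"
    assume "distinct (map snd (u @ v))"
    then show "qsh e (val M) u v = val M u * val M v"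
      using that unfolding take_vword drop_vword val_def[symmetric]
      by (intro qsh_transfer[where R = "\<lambda>u v. val M u * val M v"])
        (auto simp: B e rename_mult rename_val)
  qed
qed

text \<open>On two nonempty words both counit terms vanish; \<open>M [] = 0\<close> settles the
  pairs with an empty word.\<close>

lemma qprimitive_iff:
  fixes M :: "'g::ab_group_add mould"
  assumes M: "M \<in> ARI" and e: "\<And>k i j. inj k \<Longrightarrow> rename k (e i j) = e (k i) (k j)"
  shows "qprimitive e (val M) \<longleftrightarrow> (\<forall>p q \<sigma>. p \<ge> 1 \<longrightarrow> q \<ge> 1 \<longrightarrow> length \<sigma> = p + q \<longrightarrow>
    qsh e (val M) (take p (index_word \<sigma>)) (drop p (index_word \<sigma>)) = 0)" (is "_ \<longleftrightarrow> ?R")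
proof
  let ?T = "\<lambda>u v. val M u * counit v + counit u * val M v"
  have T0: "?T (take p (index_word \<sigma>)) (drop p (index_word \<sigma>)) = 0"
    if "p \<ge> 1" "q \<ge> 1" "length \<sigma> = p + q" for p q and \<sigma> :: "'g list"
    using that by (auto simp: counit_def)
  show ?R if "qprimitive e (val M)"
    using that distinct_split_index_word T0 unfolding qprimitive_def by metis
  show "qprimitive e (val M)" if ?R
    unfolding qprimitive_def
  proof (intro allI impI)
    fix u v :: "('g \<times> nat) list"
    assume uv: "distinct (map snd (u @ v))"
    show "qsh e (val M) u v = ?T u v"
    proof (rule qsh_transfer[where R = ?T and e = e, OF _ e _ _ _ _ uv])
      show "\<forall>p q \<sigma>. p \<ge> 1 \<longrightarrow> q \<ge> 1 \<longrightarrow> length \<sigma> = p + q \<longrightarrow>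
          qsh e (val M) (take p (index_word \<sigma>)) (drop p (index_word \<sigma>)) =
          ?T (take p (index_word \<sigma>)) (drop p (index_word \<sigma>))"
        using that T0 by metis
    qed (use M in \<open>auto simp: ARI_D counit_def rename_add rename_mult rename_val\<close>)
  qed
qed

lemma rename_star: "inj k \<Longrightarrow> rename k (star i j) = star (k i) (k j)"
  by (simp add: recip_def rename_divide rename_diff rename_rvar)

lemma ARI_al_iff: "M \<in> ARI_al \<longleftrightarrow> M \<in> ARI \<and> qprimitive (\<lambda>i j. 0) (val M)"
  by (auto simp: ARI_al_def mould_pairing_shuffle qprimitive_iff)

lemma ARI_il_iff: "M \<in> ARI_il \<longleftrightarrow> M \<in> ARI \<and> qprimitive star (val M)"
  by (auto simp: ARI_il_def mould_pairing_shuffle_star qprimitive_iff rename_star)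

lemma GARI_as_iff: "M \<in> GARI_as \<longleftrightarrow> M \<in> GARI \<and> qcharacter (\<lambda>i j. 0) (val M)"
  by (auto simp: GARI_as_def mould_pairing_shuffle qcharacter_iff)

lemma GARI_is_iff: "M \<in> GARI_is \<longleftrightarrow> M \<in> GARI \<and> qcharacter star (val M)"
  by (auto simp: GARI_is_def mould_pairing_shuffle_star qcharacter_iff rename_star)

section \<open>The four arrows and the commuting square\<close>

lemma qcharacter_cong:
  assumes "\<And>w. distinct (map snd w) \<Longrightarrow> F w = G w"
  shows "qcharacter e F \<longleftrightarrow> qcharacter e G"
proof -
  have "qsh e F u v = qsh e G u v" "F u = G u" "F v = G v" if "distinct (map snd (u @ v))" for u v
    using that assms by (auto intro!: qsh_cong simp: dwords_def)
  then show ?thesis unfolding qcharacter_def by metis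
qed

lemma qprimitive_cong:
  assumes "\<And>w. distinct (map snd w) \<Longrightarrow> F w = G w"
  shows "qprimitive e F \<longleftrightarrow> qprimitive e G"
proof -
  have "qsh e F u v = qsh e G u v" "F u = G u" "F v = G v" if "distinct (map snd (u @ v))" for u v
    using that assms by (auto intro!: qsh_cong simp: dwords_def)
  then show ?thesis unfolding qprimitive_def by metis
qed

lemma qcharacter_mould_exp:
  assumes "A \<in> ARI" "qprimitive e (val A)"
  shows "qcharacter e (val (mould_exp A))"
proof -
  have "qcharacter e (conv_exp inverse_fact (val A))"
    by (rule qcharacter_conv_exp[OF assms(2) ARI_D(3)[OF assms(1)]]) (rule rconst_inverse_fact)
  moreover have "qcharacter e (val (mould_exp A)) \<longleftrightarrow> qcharacter e (conv_exp inverse_fact (val A))"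
    by (rule qcharacter_cong) (rule val_mould_exp[OF assms(1)])
  ultimately show ?thesis by blast
qed

lemma ganit_pic_ARI: "A \<in> ARI \<Longrightarrow> ganit pic A \<in> ARI"
  and ganit_pic_GARI: "A \<in> GARI \<Longrightarrow> ganit pic A \<in> GARI"
  by (simp_all add: ARI_def GARI_def ganit_pic_BIMU)

lemma ganit_pic_GARI_is:
  assumes "A \<in> GARI_as" shows "ganit pic A \<in> GARI_is"
proof -
  have A: "A \<in> GARI" "A \<in> BIMU" "qcharacter (\<lambda>i j. 0) (val A)"
    using assms by (auto simp: GARI_as_iff GARI_def)
  have "qcharacter star (val (ganit pic A)) \<longleftrightarrow> qcharacter star (contr (recip rvar) (val A))"
    by (rule qcharacter_cong) (rule val_ganit_pic[OF A(2)])
  then show ?thesis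
    using qcharacter_contr[OF inj_rvar A(3)]
    by (simp add: GARI_is_iff ganit_pic_GARI A(1))
qed

lemma ganit_pic_ARI_il:
  assumes "A \<in> ARI_al" shows "ganit pic A \<in> ARI_il"
proof -
  have A: "A \<in> ARI" "A \<in> BIMU" "qprimitive (\<lambda>i j. 0) (val A)"
    using assms by (auto simp: ARI_al_iff ARI_def)
  have "qprimitive star (val (ganit pic A)) \<longleftrightarrow> qprimitive star (contr (recip rvar) (val A))"
    by (rule qprimitive_cong) (rule val_ganit_pic[OF A(2)])
  then show ?thesis
    using qprimitive_contr[OF inj_rvar A(3)]
    by (simp add: ARI_il_iff ganit_pic_ARI A(1))
qed

text \<open>The exponential at \<open>w\<close> evaluates \<open>F\<close> only at contiguous pieces
  of \<open>w\<close>, which stay in \<open>dwords S\<close>. This suits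
  \<open>val_ganit_pic\<close>, an identity for distinct variables only.\<close>

lemma conv_exp_cong:
  assumes "\<And>w. w \<in> dwords S \<Longrightarrow> F w = G w" "w \<in> dwords S"
  shows "conv_exp \<rho> F w = conv_exp \<rho> G w"
proof -
  have "conv_power F k w = conv_power G k w" if "w \<in> dwords S" for k w
    using that
  proof (induction k arbitrary: w)
    case (Suc k)
    then show ?case
      using assms(1) unfolding conv_power.simps conv_def
      by (intro deconc_cong arg_cong2[of _ _ _ _ "(*)"]) (auto simp: dwords_def image_Un)
  qed simp
  then show ?thesis using assms(2) by (simp add: conv_exp_def)
qed

lemma ganit_pic_mould_exp:
  assumes "A \<in> ARI" shows "ganit pic (mould_exp A) = mould_exp (ganit pic A)"
proof
  fix \<sigma> :: "'a list"
  let ?w = "index_word \<sigma>" and ?C = "contr (recip rvar)"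
  have "mould_exp A \<in> BIMU"
    using mould_exp_GARI[OF assms] by (simp add: GARI_def)
  then have "ganit pic (mould_exp A) \<sigma> = ?C (val (mould_exp A)) ?w"
    by (rule ganit_pic_eq)
  also have "\<dots> = ?C (conv_exp inverse_fact (val A)) ?w"
    using assms by (intro contr_cong val_mould_exp) (auto simp: dwords_def)
  also have "\<dots> = conv_exp inverse_fact (?C (val A)) ?w"
    using assms by (intro contr_conv_exp) (simp_all add: ARI_D)
  also have "\<dots> = conv_exp inverse_fact (val (ganit pic A)) ?w"
    using assms index_word_dwords
    by (intro conv_exp_cong[of "{..<length \<sigma>}"]) (auto simp: val_ganit_pic ARI_D dwords_def)
  also have "\<dots> = mould_exp (ganit pic A) \<sigma>"
    using assms by (simp add: mould_exp_eq ganit_pic_ARI)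
  finally show "ganit pic (mould_exp A) \<sigma> = mould_exp (ganit pic A) \<sigma>" .
qed

theorem corollary3p25:
  shows "(\<forall>A \<in> (ARI_al :: 'g::{finite, ab_group_add} mould set). mould_exp A \<in> GARI_as) \<and>
    (\<forall>A \<in> (ARI_il :: 'g mould set). mould_exp A \<in> GARI_is) \<and>
    (\<forall>A \<in> (GARI_as :: 'g mould set). ganit pic A \<in> GARI_is) \<and>
    (\<forall>A \<in> (ARI_al :: 'g mould set). ganit pic A \<in> ARI_il) \<and>
    (\<forall>A \<in> (ARI_al :: 'g mould set). ganit pic (mould_exp A) = mould_exp (ganit pic A))"
proof -
  have "mould_exp A \<in> GARI_as" if "A \<in> ARI_al" for A :: "'g mould"
    using that by (simp add: ARI_al_iff GARI_as_iff mould_exp_GARI qcharacter_mould_exp)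
  moreover have "mould_exp A \<in> GARI_is" if "A \<in> ARI_il" for A :: "'g mould"
    using that by (simp add: ARI_il_iff GARI_is_iff mould_exp_GARI qcharacter_mould_exp)
  moreover have "A \<in> ARI" if "A \<in> ARI_al" for A :: "'g mould"
    using that by (simp add: ARI_al_iff)
  ultimately show ?thesis
    by (simp add: ganit_pic_GARI_is ganit_pic_ARI_il ganit_pic_mould_exp)
qed

end
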